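(* Let $A$ be a commutative Noetherian ring, $\mathfrak q$ an ideal of $A$, $G=G_A(\mathfrak q)$ and $Q\subseteq G$ as in the context. Assume there are integers $k$ and $t$ such that $[H^i_Q(G)]_{n-i}=0$ for all $n\ne k-1,k$ and all $0\le i<t$, and $[H^t_Q(G)]_{n-t}=0$ for all $n>k$. Then the canonical homomorphisms $f^i_A: H^i(\mathfrak q;A)\to H^i_{\mathfrak q}(A)$ are surjective for all $i<t$ if and only if the canonical homomorphisms $f^i_G: H^i(Q;G)\to H^i_Q(G)$ are surjective for all $i<t$.
   Context: $G=G_A(\mathfrak q)=\bigoplus_{n\ge0}\mathfrak q^n/\mathfrak q^{n+1}$ is the form ring and $Q$ is the homogeneous ideal of $G$ generated by the initial forms of elements of $\mathfrak q$ (equivalently $Q=G_+$). For a graded $G$-module $M$, $[M]_k$ denotes its degree-$k$ component and $M(p)$ the shifted module with $[M(p)]_n=[M]_{p+n}$. Fix generators $x_1,\dots,x_m$ of $\mathfrak q$ and let $x_1^*,\dots,x_m^*\in G_1=\mathfrak q/\mathfrak q^2$ be their images (which generate $Q$). $H^i(\mathfrak q;A)$ is the Koszul cohomology of $A$ with respect to $x_1,\dots,x_m$, and $H^i(Q;G)$ is the graded Koszul cohomology of $G$ with respect to $x_1^*,\dots,x_m^*$, graded so that the $p$-th term of the Koszul cochain complex is $G(p)^{\binom mp}$; these do not depend (up to isomorphism) on the chosen generators. $f^i_A:H^i(\mathfrak q;A)\to H^i_{\mathfrak q}(A)$ and $f^i_G:H^i(Q;G)\to H^i_Q(G)$ are the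 canonical homomorphisms from Koszul cohomology into local cohomology (via $H^i_{\mathfrak q}(A)\cong\varinjlim_n H^i(x_1^n,\dots,x_m^n;A)$, and similarly for $G$). *)

theory Defs
  imports Main
begin

definition is_ideal :: "'a::comm_ring_1 set \<Rightarrow> bool" where
  "is_ideal I \<longleftrightarrow> 0 \<in> I \<and> (\<forall>a\<in>I. \<forall>b\<in>I. a + b \<in> I) \<and> (\<forall>r. \<forall>a\<in>I. r * a \<in> I)"

definition ideal_gen :: "'a::comm_ring_1 set \<Rightarrow> 'a set" where
  "ideal_gen S = \<Inter>{I. is_ideal I \<and> S \<subseteq> I}"

definition noetherian_ring :: "'a::comm_ring_1 itself \<Rightarrow> bool" where
  "noetherian_ring _ \<longleftrightarrow> (\<forall>I::'a set. is_ideal I \<longrightarrow> (\<exists>F. finite F \<and> I = ideal_gen F))"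

fun ideal_pow :: "'a::comm_ring_1 set \<Rightarrow> nat \<Rightarrow> 'a set" where
  "ideal_pow q 0 = UNIV"
| "ideal_pow q (Suc n) = ideal_gen {a * b | a b. a \<in> ideal_pow q n \<and> b \<in> q}"

text \<open>q^k for integer k, with q^k = A for k \<le> 0; then q^k/q^(k+1) is the degree-k
  component of the form ring G, which is 0 for k < 0.\<close>
definition qp :: "'a::comm_ring_1 set \<Rightarrow> int \<Rightarrow> 'a set" where
  "qp q k = (if k \<le> 0 then UNIV else ideal_pow q (nat k))"

text \<open>A p-cochain assigns a ring element to each p-subset of {..<m} (basis e_T).\<close>
definition cochains :: "nat \<Rightarrow> nat \<Rightarrow> (nat set \<Rightarrow> 'a::comm_ring_1) set" where
  "cochains m p = {c. \<forall>T. c T \<noteq> 0 \<longrightarrow> T \<subseteq> {..<m} \<and> card T = p}"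

definition ksgn :: "nat \<Rightarrow> nat set \<Rightarrow> 'a::comm_ring_1" where
  "ksgn j T = (-1) ^ card {i\<in>T. i < j}"

text \<open>Differential d(e_S) = sum over j not in S of y_j e_j \<and> e_S.\<close>
definition kdiff :: "nat \<Rightarrow> (nat \<Rightarrow> 'a::comm_ring_1) \<Rightarrow> (nat set \<Rightarrow> 'a) \<Rightarrow> nat set \<Rightarrow> 'a" where
  "kdiff m y c T = (if T \<subseteq> {..<m} then (\<Sum>j\<in>T. ksgn j T * y j * c (T - {j})) else 0)"

definition xpow :: "'a::comm_ring_1 list \<Rightarrow> nat \<Rightarrow> nat \<Rightarrow> 'a" where
  "xpow xs n j = (xs ! j) ^ n"

text \<open>Transition map of the direct system K(x^n) \<rightarrow> K(x^N), n \<le> N: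
  e_T \<mapsto> (prod_(j\<in>T) x_j^(N-n)) e_T.\<close>
definition ktrans :: "'a::comm_ring_1 list \<Rightarrow> nat \<Rightarrow> nat \<Rightarrow> (nat set \<Rightarrow> 'a) \<Rightarrow> nat set \<Rightarrow> 'a" where
  "ktrans xs n N c T = (\<Prod>j\<in>T. (xs ! j) ^ (N - n)) * c T"

definition cocyclesA :: "nat \<Rightarrow> (nat \<Rightarrow> 'a::comm_ring_1) \<Rightarrow> nat \<Rightarrow> (nat set \<Rightarrow> 'a) set" where
  "cocyclesA m y p = {c \<in> cochains m p. kdiff m y c = (\<lambda>_. 0)}"

definition coboundariesA :: "nat \<Rightarrow> (nat \<Rightarrow> 'a::comm_ring_1) \<Rightarrow> nat \<Rightarrow> (nat set \<Rightarrow> 'a) set" where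
  "coboundariesA m y p = (if p = 0 then {\<lambda>_. 0} else kdiff m y ` cochains m (p - 1))"

text \<open>f^i_A : H^i(x;A) \<rightarrow> lim_n H^i(x^n;A) = H^i_q(A) is surjective: every class at
  level n is, at some later level N, the image of a class from level 1.\<close>
definition fA_surj :: "'a::comm_ring_1 list \<Rightarrow> nat \<Rightarrow> bool" where
  "fA_surj xs i \<longleftrightarrow>
     (\<forall>n\<ge>1. \<forall>z \<in> cocyclesA (length xs) (xpow xs n) i.
        \<exists>w \<in> cocyclesA (length xs) (xpow xs 1) i. \<exists>N\<ge>n.
          (\<lambda>T. ktrans xs 1 N w T - ktrans xs n N z T) \<in> coboundariesA (length xs) (xpow xs N) i)"

text \<open>Degree-e part of K^p(x*^n; G) = G(p n)^(m choose p): a p-cochain with values in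
  G_(e+pn) = q^(e+pn)/q^(e+pn+1), represented by elements of q^(e+pn); two
  representatives are identified modulo q^(e+pn+1).\<close>
definition Gcochains :: "'a::comm_ring_1 set \<Rightarrow> nat \<Rightarrow> nat \<Rightarrow> int \<Rightarrow> nat \<Rightarrow> (nat set \<Rightarrow> 'a) set" where
  "Gcochains q m n e p = {c \<in> cochains m p. \<forall>T. c T \<in> qp q (e + int p * int n)}"

definition Gcocycle :: "'a::comm_ring_1 set \<Rightarrow> 'a list \<Rightarrow> nat \<Rightarrow> int \<Rightarrow> nat \<Rightarrow> (nat set \<Rightarrow> 'a) \<Rightarrow> bool" where
  "Gcocycle q xs n e p c \<longleftrightarrow> c \<in> Gcochains q (length xs) n e p \<and>
     (\<forall>T. kdiff (length xs) (xpow xs n) c T \<in> qp q (e + int (p + 1) * int n + 1))"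

definition Gcobdry :: "'a::comm_ring_1 set \<Rightarrow> 'a list \<Rightarrow> nat \<Rightarrow> int \<Rightarrow> nat \<Rightarrow> (nat set \<Rightarrow> 'a) \<Rightarrow> bool" where
  "Gcobdry q xs n e p c \<longleftrightarrow>
     (if p = 0 then (\<forall>T. c T \<in> qp q (e + 1))
      else (\<exists>b \<in> Gcochains q (length xs) n e (p - 1).
              \<forall>T. c T - kdiff (length xs) (xpow xs n) b T \<in> qp q (e + int p * int n + 1)))"

text \<open>[H^i_Q(G)]_e = [lim_n H^i(x*^n;G)]_e = 0.\<close>
definition LCG_zero :: "'a::comm_ring_1 set \<Rightarrow> 'a list \<Rightarrow> nat \<Rightarrow> int \<Rightarrow> bool" where
  "LCG_zero q xs i e \<longleftrightarrow>
     (\<forall>n\<ge>1. \<forall>z. Gcocycle q xs n e i z \<longrightarrow> (\<exists>N\<ge>n. Gcobdry q xs N e i (ktrans xs n N z)))"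

definition fG_surj :: "'a::comm_ring_1 set \<Rightarrow> 'a list \<Rightarrow> nat \<Rightarrow> bool" where
  "fG_surj q xs i \<longleftrightarrow>
     (\<forall>e::int. \<forall>n\<ge>1. \<forall>z. Gcocycle q xs n e i z \<longrightarrow>
        (\<exists>w. Gcocycle q xs 1 e i w \<and> (\<exists>N\<ge>n.
           Gcobdry q xs N e i (\<lambda>T. ktrans xs 1 N w T - ktrans xs n N z T))))"

end

theory Submission
  imports Defs "HOL-Library.Function_Algebras" "HOL-Library.List_Lexorder"
begin

text \<open>
  Filter the complexes \<open>K(x\<^sup>n; A)\<close> by the powers of \<open>q\<close>, with \<open>F\<^sup>e\<close> in cohomological degree \<open>p\<close> given by
  the entries in \<open>q\<^bsup>e+pn\<^esup>\<close>. The graded pieces are the complexes \<open>K(x*\<^sup>n; G)\<close>, and \<open>F\<^sup>e\<close> itself is the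
  degree \<open>e\<close> part of the Koszul complex of the extended Rees algebra \<open>R\<close>. Artin--Rees gives
  \<open>H\<^sup>i(F\<^sup>e) = 0\<close> for large \<open>e\<close>, uniformly in \<open>n\<close>; with the hypotheses on \<open>G\<close> this yields
  \<open>[H\<^sup>i\<^sub>Q(R)]\<^sub>e = 0\<close> for \<open>e + i > k\<close> and \<open>i \<le> t\<close>.

  Trading the exponent \<open>n\<close> for the exponent 1 one variable at a time compares local with Koszul
  cohomology. If local cohomology vanishes on the diagonal \<open>e + i = s\<close>, so does Koszul
  cohomology, and Koszul cohomology maps onto local cohomology on the diagonal \<open>e + i = s - 1\<close>.
  Hence everything for \<open>R\<close> vanishes on the diagonal \<open>k + 1\<close> and surjectivity is automatic on the
  diagonal \<open>k\<close>. On the remaining diagonal \<open>k - 1\<close>, cocycles over \<open>G\<close> lift to \<open>R\<close> because the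
  obstructions lie on the diagonal \<open>k + 1\<close>, while the vanishing for \<open>G\<close> below the diagonal
  \<open>k - 1\<close> moves cocycles and coboundaries over \<open>A\<close> into \<open>F\<^bsup>k-1-i\<^esup>\<close>.
\<close>

section \<open>Koszul complexes\<close>

text \<open>Singling out a generator \<open>x l\<close> presents a Koszul complex as the mapping
  cone of multiplication by a power of \<open>x l\<close> (\<open>join\<close>,
  \<open>D_join\<close>); all comparisons are made on the resulting pairs of cochains. Write H(l)
  for the colimit cohomology in which the first l exponents stay 1. There is an exact sequence
  H(l)^(p-1)_(e+1) -> H(l+1)^p_e -> H(l)^p_e -> H(l)^p_(e+1), the last map being multiplication by
  \<open>x l\<close>. It explains the diagonals: the two neighbours whose vanishing forces that of
  H(l+1)^p_e have the same sum of degrees, and the obstruction to surjectivity lies one diagonal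
  higher. Artin-Rees is applied only with all exponents 1; the cones carry its bound unchanged to
  every exponent n. The obstacle in passing from A to G is that surjectivity over A does not control
  the filtration level of the Koszul cocycle or of the coboundary. Both must be moved up to the
  level of the given class, the cocycle without changing its exponent 1; hence the vanishing of
  local cohomology of G has to be converted into vanishing of its Koszul cohomology.\<close>

lemma is_ideal_zero: "is_ideal I \<Longrightarrow> 0 \<in> I"
  and is_ideal_add: "is_ideal I \<Longrightarrow> a \<in> I \<Longrightarrow> b \<in> I \<Longrightarrow> a + b \<in> I"
  and is_ideal_mult: "is_ideal I \<Longrightarrow> a \<in> I \<Longrightarrow> r * a \<in> I"
  by (auto simp: is_ideal_def)

lemma is_ideal_sum: "is_ideal I \<Longrightarrow> (\<And>j. j \<in> S \<Longrightarrow> f j \<in> I) \<Longrightarrow> sum f S \<in> I"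
  by (induction S rule: infinite_finite_induct) (auto simp: is_ideal_zero is_ideal_add)

definition scal :: "'a::comm_ring_1 \<Rightarrow> ('s \<Rightarrow> 'a) \<Rightarrow> 's \<Rightarrow> 'a"  (infixr "\<odot>" 75)
  where "a \<odot> c = (\<lambda>s. a * c s)"

lemma scal_apply [simp]: "(a \<odot> c) s = a * c s"
  by (simp add: scal_def)

lemma scal_simps [simp]:
  "a \<odot> (0 :: 's \<Rightarrow> 'a::comm_ring_1) = 0" "0 \<odot> c = 0" "1 \<odot> c = c"
  "a \<odot> b \<odot> c = (a * b) \<odot> c" "a \<odot> (- c) = - (a \<odot> c)"
  by (auto simp: fun_eq_iff mult.assoc)

lemma scal_distrib:
  "a \<odot> (b + c) = a \<odot> b + a \<odot> c" "a \<odot> (b - c) = a \<odot> b - a \<odot> c"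
  for a :: "'a::comm_ring_1" and b c :: "'s \<Rightarrow> 'a"
  by (auto simp: fun_eq_iff algebra_simps)

locale koszul =
  fixes x :: "nat \<Rightarrow> 'a::comm_ring_1" and m :: nat
begin

text \<open>An arbitrary index set \<open>J\<close> permits induction on the generators, and
  separate exponents \<open>\<nu> j\<close> permit changing one exponent at a time;
  \<open>kdiff\<close> is the case of constant exponents on all generators.\<close>

definition D :: "nat set \<Rightarrow> (nat \<Rightarrow> nat) \<Rightarrow> (nat set \<Rightarrow> 'a) \<Rightarrow> nat set \<Rightarrow> 'a" where
  "D J \<nu> c T = (if T \<subseteq> J then \<Sum>j\<in>T. ksgn j T * x j ^ \<nu> j * c (T - {j}) else 0)"

definition \<Phi> :: "(nat \<Rightarrow> nat) \<Rightarrow> (nat \<Rightarrow> nat) \<Rightarrow> (nat set \<Rightarrow> 'a) \<Rightarrow> nat set \<Rightarrow> 'a" where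
  "\<Phi> \<nu> \<mu> c T = (\<Prod>j\<in>T. x j ^ (\<mu> j - \<nu> j)) * c T"

definition supp :: "nat set \<Rightarrow> (nat set \<Rightarrow> 'a) \<Rightarrow> bool" where
  "supp J c \<longleftrightarrow> (\<forall>T. c T \<noteq> 0 \<longrightarrow> T \<subseteq> J)"

text \<open>\<open>W e\<close> plays the role of the degree e component of a graded module. The
  twist by \<open>sum \<nu> T\<close> makes \<open>D\<close> homogeneous of degree 0; for constant
  \<nu> = n it is the twist e + pn.\<close>

definition Coch :: "(int \<Rightarrow> 'a set) \<Rightarrow> nat set \<Rightarrow> (nat \<Rightarrow> nat) \<Rightarrow> int \<Rightarrow> int \<Rightarrow> (nat set \<Rightarrow> 'a) set" where
  "Coch W J \<nu> e p = {c. \<forall>T. (c T \<noteq> 0 \<longrightarrow> T \<subseteq> J \<and> int (card T) = p) \<and> c T \<in> W (e + int (sum \<nu> T))}"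

definition stable :: "(int \<Rightarrow> 'a set) \<Rightarrow> bool" where
  "stable W \<longleftrightarrow> (\<forall>e. is_ideal (W e)) \<and> (\<forall>e. \<forall>j<m. \<forall>a\<in>W e. x j * a \<in> W (e + 1))"

text \<open>This is the cochain a + e_l wedge b; the sign moves e_l to its place in the increasing
  order of T.\<close>

definition join :: "nat \<Rightarrow> (nat set \<Rightarrow> 'a) \<Rightarrow> (nat set \<Rightarrow> 'a) \<Rightarrow> nat set \<Rightarrow> 'a" where
  "join l a b T = (if l \<in> T then ksgn l T * b (T - {l}) else a T)"

lemma stable_ideal: "stable W \<Longrightarrow> is_ideal (W e)"
  by (simp add: stable_def)

lemma stable_power: "stable W \<Longrightarrow> j < m \<Longrightarrow> a \<in> W e \<Longrightarrow> x j ^ n * a \<in> W (e + int n)"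
proof (induction n)
  case (Suc n)
  then have "x j * (x j ^ n * a) \<in> W (e + int n + 1)"
    by (simp add: stable_def)
  then show ?case by (simp add: algebra_simps)
qed simp

lemma stable_prod_power:
  "stable W \<Longrightarrow> T \<subseteq> {..<m} \<Longrightarrow> a \<in> W e \<Longrightarrow> (\<Prod>j\<in>T. x j ^ f j) * a \<in> W (e + int (sum f T))"
proof (induction T rule: infinite_finite_induct)
  case (insert j T)
  then have "x j ^ f j * ((\<Prod>j\<in>T. x j ^ f j) * a) \<in> W (e + int (sum f T) + int (f j))"
    by (intro stable_power) auto
  with insert.hyps show ?case by (simp add: algebra_simps)
qed auto

lemma D_diff: "D J \<nu> (a - b) = D J \<nu> a - D J \<nu> b"
  by (auto simp: D_def fun_eq_iff sum_subtractf algebra_simps)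

lemma D_add: "D J \<nu> (a + b) = D J \<nu> a + D J \<nu> b"
  by (auto simp: D_def fun_eq_iff sum.distrib algebra_simps)

lemma D_zero [simp]: "D J \<nu> 0 = 0"
  by (auto simp: D_def fun_eq_iff)

lemma D_uminus: "D J \<nu> (- a) = - D J \<nu> a"
  using D_diff[of J \<nu> 0 a] by simp

lemma D_scal: "D J \<nu> (r \<odot> a) = r \<odot> D J \<nu> a"
  by (auto simp: D_def fun_eq_iff sum_distrib_left algebra_simps intro!: sum.cong)

lemmas D_linear = D_diff D_add D_uminus D_scal

lemma \<Phi>_linear:
  "\<Phi> \<nu> \<mu> (a - b) = \<Phi> \<nu> \<mu> a - \<Phi> \<nu> \<mu> b" "\<Phi> \<nu> \<mu> (a + b) = \<Phi> \<nu> \<mu> a + \<Phi> \<nu> \<mu> b"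
  "\<Phi> \<nu> \<mu> (- a) = - \<Phi> \<nu> \<mu> a" "\<Phi> \<nu> \<mu> (r \<odot> a) = r \<odot> \<Phi> \<nu> \<mu> a"
  by (auto simp: \<Phi>_def fun_eq_iff algebra_simps)

lemma \<Phi>_zero [simp]: "\<Phi> \<nu> \<mu> 0 = 0"
  by (auto simp: \<Phi>_def fun_eq_iff)

lemma \<Phi>_same [simp]: "\<Phi> \<nu> \<nu> c = c"
  by (auto simp: \<Phi>_def fun_eq_iff)

lemma \<Phi>_comp:
  assumes "supp J c" "\<And>j. j \<in> J \<Longrightarrow> \<nu> j \<le> \<mu> j \<and> \<mu> j \<le> \<kappa> j"
  shows "\<Phi> \<mu> \<kappa> (\<Phi> \<nu> \<mu> c) = \<Phi> \<nu> \<kappa> c"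
proof
  fix T
  show "\<Phi> \<mu> \<kappa> (\<Phi> \<nu> \<mu> c) T = \<Phi> \<nu> \<kappa> c T"
  proof (cases "c T = 0")
    case False
    with assms have T: "T \<subseteq> J" by (auto simp: supp_def)
    have "(\<Prod>j\<in>T. x j ^ (\<kappa> j - \<mu> j)) * (\<Prod>j\<in>T. x j ^ (\<mu> j - \<nu> j)) = (\<Prod>j\<in>T. x j ^ (\<kappa> j - \<nu> j))"
      unfolding prod.distrib[symmetric]
      by (rule prod.cong) (use assms T in \<open>auto simp: power_add[symmetric] subset_iff\<close>)
    then show ?thesis by (simp add: \<Phi>_def mult.assoc[symmetric])
  qed (simp add: \<Phi>_def)
qed

lemma \<Phi>_D:
  assumes "finite J" "\<And>j. j \<in> J \<Longrightarrow> \<nu> j \<le> \<mu> j"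
  shows "D J \<mu> (\<Phi> \<nu> \<mu> c) = \<Phi> \<nu> \<mu> (D J \<nu> c)"
proof
  fix T
  show "D J \<mu> (\<Phi> \<nu> \<mu> c) T = \<Phi> \<nu> \<mu> (D J \<nu> c) T"
  proof (cases "T \<subseteq> J")
    case True
    have fT: "finite T" using True assms finite_subset by blast
    have "x j ^ \<mu> j * (\<Prod>i\<in>T - {j}. x i ^ (\<mu> i - \<nu> i)) = x j ^ \<nu> j * (\<Prod>i\<in>T. x i ^ (\<mu> i - \<nu> i))"
      if "j \<in> T" for j
    proof -
      have "x j ^ \<mu> j = x j ^ \<nu> j * x j ^ (\<mu> j - \<nu> j)"
        using assms(2)[of j] that True by (auto simp: power_add[symmetric])
      then show ?thesis
        using prod.remove[OF fT that, of "\<lambda>i. x i ^ (\<mu> i - \<nu> i)"] by (simp add: mult.assoc)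
    qed
    then have "ksgn j T * x j ^ \<mu> j * \<Phi> \<nu> \<mu> c (T - {j}) =
        (\<Prod>i\<in>T. x i ^ (\<mu> i - \<nu> i)) * (ksgn j T * x j ^ \<nu> j * c (T - {j}))" if "j \<in> T" for j
      unfolding \<Phi>_def using that by (smt (verit) mult.assoc mult.commute)
    then show ?thesis
      using True by (simp add: D_def \<Phi>_def[of _ _ "D J \<nu> c"] sum_distrib_left)
  qed (simp add: D_def \<Phi>_def)
qed

lemma Coch_supp: "c \<in> Coch W J \<nu> e p \<Longrightarrow> supp J c"
  by (auto simp: Coch_def supp_def)

lemma Coch_zero: "stable W \<Longrightarrow> 0 \<in> Coch W J \<nu> e p"
  by (auto simp: Coch_def stable_ideal is_ideal_zero)

lemma Coch_add: "stable W \<Longrightarrow> a \<in> Coch W J \<nu> e p \<Longrightarrow> b \<in> Coch W J \<nu> e p \<Longrightarrow> a + b \<in> Coch W J \<nu> e p"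
proof -
  assume W: "stable W" and ab: "a \<in> Coch W J \<nu> e p" "b \<in> Coch W J \<nu> e p"
  have "(a + b) T \<noteq> 0 \<Longrightarrow> a T \<noteq> 0 \<or> b T \<noteq> 0" for T by auto
  with ab is_ideal_add[OF stable_ideal[OF W]] show "a + b \<in> Coch W J \<nu> e p"
    by (simp add: Coch_def) blast
qed

lemma Coch_scal: "stable W \<Longrightarrow> a \<in> Coch W J \<nu> e p \<Longrightarrow> r \<odot> a \<in> Coch W J \<nu> e p"
  unfolding Coch_def by simp (metis is_ideal_mult mult_zero_right stable_ideal)

lemma Coch_uminus: "stable W \<Longrightarrow> a \<in> Coch W J \<nu> e p \<Longrightarrow> - a \<in> Coch W J \<nu> e p"
  using Coch_scal[of W a J \<nu> e p "-1"] by (simp add: scal_def fun_Compl_def)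

lemma Coch_diff: "stable W \<Longrightarrow> a \<in> Coch W J \<nu> e p \<Longrightarrow> b \<in> Coch W J \<nu> e p \<Longrightarrow> a - b \<in> Coch W J \<nu> e p"
  using Coch_add[of W a J \<nu> e p "- b"] Coch_uminus[of W b] by simp

lemma Coch_power:
  assumes "stable W" "l < m" "a \<in> Coch W J \<nu> e p"
  shows "x l ^ n \<odot> a \<in> Coch W J \<nu> (e + int n) p"
proof -
  have "x l ^ n * a T \<in> W (e + int n + int (sum \<nu> T))" for T
    using stable_power[OF assms(1,2), of "a T" "e + int (sum \<nu> T)" n] assms(3)
    by (simp add: Coch_def ac_simps)
  moreover have "x l ^ n * a T \<noteq> 0 \<Longrightarrow> a T \<noteq> 0" for T by auto
  ultimately show ?thesis using assms(3) by (simp add: Coch_def)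
qed

lemma Coch_x: "stable W \<Longrightarrow> l < m \<Longrightarrow> a \<in> Coch W J \<nu> e p \<Longrightarrow> x l \<odot> a \<in> Coch W J \<nu> (e + 1) p"
  using Coch_power[of W l a J \<nu> e p 1] by simp

lemma Coch_cong: "(\<And>j. j \<in> J \<Longrightarrow> \<nu> j = \<mu> j) \<Longrightarrow> Coch W J \<nu> e p = Coch W J \<mu> e p" if "\<And>e. 0 \<in> W e"
proof -
  assume eq: "\<And>j. j \<in> J \<Longrightarrow> \<nu> j = \<mu> j"
  have "sum \<nu> T = sum \<mu> T" if "T \<subseteq> J" for T
    using eq that by (intro sum.cong) auto
  then show ?thesis
    unfolding Coch_def using that by (intro Collect_cong all_cong1) metis
qed

lemma D_cong: "(\<And>j. j \<in> J \<Longrightarrow> \<nu> j = \<mu> j) \<Longrightarrow> D J \<nu> = D J \<mu>"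
proof (intro ext)
  fix c T
  assume eq: "\<And>j. j \<in> J \<Longrightarrow> \<nu> j = \<mu> j"
  show "D J \<nu> c T = D J \<mu> c T"
  proof (cases "T \<subseteq> J")
    case True
    then have "(\<Sum>j\<in>T. ksgn j T * x j ^ \<nu> j * c (T - {j})) = (\<Sum>j\<in>T. ksgn j T * x j ^ \<mu> j * c (T - {j}))"
      using eq by (intro sum.cong) auto
    then show ?thesis by (simp add: D_def)
  qed (simp add: D_def)
qed

lemma \<Phi>_cong:
  assumes "supp J c" "\<And>j. j \<in> J \<Longrightarrow> \<nu> j = \<nu>' j \<and> \<mu> j = \<mu>' j"
  shows "\<Phi> \<nu> \<mu> c = \<Phi> \<nu>' \<mu>' c"
proof
  fix T
  show "\<Phi> \<nu> \<mu> c T = \<Phi> \<nu>' \<mu>' c T"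
  proof (cases "c T = 0")
    case False
    with assms have "T \<subseteq> J" by (auto simp: supp_def)
    then have "(\<Prod>j\<in>T. x j ^ (\<mu> j - \<nu> j)) = (\<Prod>j\<in>T. x j ^ (\<mu>' j - \<nu>' j))"
      using assms(2) by (intro prod.cong) auto
    then show ?thesis by (simp add: \<Phi>_def)
  qed (simp add: \<Phi>_def)
qed

lemma D_Coch:
  assumes "stable W" "J \<subseteq> {..<m}" "c \<in> Coch W J \<nu> e p"
  shows "D J \<nu> c \<in> Coch W J \<nu> e (p + 1)"
proof -
  have "(D J \<nu> c T \<noteq> 0 \<longrightarrow> T \<subseteq> J \<and> int (card T) = p + 1) \<and> D J \<nu> c T \<in> W (e + int (sum \<nu> T))" for T
  proof (cases "T \<subseteq> J")
    case True
    then have fT: "finite T" using assms(2) finite_subset[OF _ finite_lessThan[of m]] by simp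
    have "D J \<nu> c T = (\<Sum>j\<in>T. ksgn j T * x j ^ \<nu> j * c (T - {j}))"
      using True by (simp add: D_def)
    moreover have "ksgn j T * x j ^ \<nu> j * c (T - {j}) \<in> W (e + int (sum \<nu> T))" if "j \<in> T" for j
    proof -
      have "c (T - {j}) \<in> W (e + int (sum \<nu> (T - {j})))"
        using assms(3) by (auto simp: Coch_def)
      then have "x j ^ \<nu> j * c (T - {j}) \<in> W (e + int (sum \<nu> (T - {j})) + int (\<nu> j))"
        using assms True that by (intro stable_power) auto
      also have "e + int (sum \<nu> (T - {j})) + int (\<nu> j) = e + int (sum \<nu> T)"
        using sum.remove[OF fT that, of \<nu>] by simp
      finally show ?thesis
        using is_ideal_mult[OF stable_ideal[OF assms(1)]] by (simp add: mult.assoc)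
    qed
    moreover have "int (card T) = p + 1" if "D J \<nu> c T \<noteq> 0"
    proof -
      have "\<exists>j\<in>T. c (T - {j}) \<noteq> 0"
        using that True by (force simp: D_def intro: sum.neutral)
      then obtain j where j: "j \<in> T" "int (card (T - {j})) = p"
        using assms(3) by (auto simp: Coch_def)
      have "card T > 0" using j fT card_gt_0_iff by blast
      with j fT show ?thesis by simp
    qed
    moreover have "(\<Sum>j\<in>T. ksgn j T * x j ^ \<nu> j * c (T - {j})) \<in> W (e + int (sum \<nu> T))"
      by (rule is_ideal_sum[OF stable_ideal[OF assms(1)]]) fact
    ultimately show ?thesis
      using True by metis
  next
    case False
    then show ?thesis by (simp add: D_def is_ideal_zero stable_ideal[OF assms(1)])
  qed
  then show ?thesis by (simp add: Coch_def)
qed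

lemma \<Phi>_Coch:
  assumes "stable W" "J \<subseteq> {..<m}" "\<And>j. j \<in> J \<Longrightarrow> \<nu> j \<le> \<mu> j" "c \<in> Coch W J \<nu> e p"
  shows "\<Phi> \<nu> \<mu> c \<in> Coch W J \<mu> e p"
proof -
  have "\<Phi> \<nu> \<mu> c T \<in> W (e + int (sum \<mu> T))" for T
  proof (cases "c T = 0")
    case True
    then show ?thesis by (simp add: \<Phi>_def is_ideal_zero stable_ideal[OF assms(1)])
  next
    case False
    then have T: "T \<subseteq> J" "c T \<in> W (e + int (sum \<nu> T))" using assms(4) by (auto simp: Coch_def)
    then have "\<Phi> \<nu> \<mu> c T \<in> W (e + int (sum \<nu> T) + int (\<Sum>j\<in>T. \<mu> j - \<nu> j))"
      unfolding \<Phi>_def using assms by (intro stable_prod_power) auto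
    moreover have "sum \<nu> T + (\<Sum>j\<in>T. \<mu> j - \<nu> j) = sum \<mu> T"
      unfolding sum.distrib[symmetric] using assms(3) T by (intro sum.cong) auto
    ultimately show ?thesis by (metis add.assoc of_nat_add)
  qed
  moreover have "\<Phi> \<nu> \<mu> c T \<noteq> 0 \<Longrightarrow> c T \<noteq> 0" for T by (auto simp: \<Phi>_def)
  ultimately show ?thesis using assms(4) by (auto simp: Coch_def)
qed

lemma ksgn_square [simp]: "ksgn j T * ksgn j T = (1::'b::comm_ring_1)"
  by (simp add: ksgn_def power_add[symmetric] mult_2[symmetric] power_mult)

lemma ksgn_square' [simp]: "ksgn j T * (ksgn j T * a) = (a::'b::comm_ring_1)"
  by (simp add: mult.assoc[symmetric])

lemma ksgn_remove_self [simp]: "ksgn l (T - {l}) = ksgn l T"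
  unfolding ksgn_def by (metis (no_types, lifting) DiffE DiffI insertE less_irrefl singletonI empty_iff)

text \<open>Deleting an index flips the sign attached to every larger index and leaves that of every
  smaller one, so exactly one of the two orders of deletion picks up a minus sign.\<close>

lemma ksgn_swap:
  assumes "finite T" "j \<in> T" "l \<in> T" "j \<noteq> l"
  shows "ksgn j T * ksgn l (T - {j}) = - (ksgn l T * ksgn j (T - {l}) :: 'b::comm_ring_1)"
proof -
  have rem: "ksgn i (T - {k}) = (if k < i then - ksgn i T else (ksgn i T :: 'b))"
    if "i \<in> T" "k \<in> T" "i \<noteq> k" for i k
  proof (cases "k < i")
    case True
    then have "{a \<in> T. a < i} = insert k {a \<in> T - {k}. a < i}" using that by auto
    then have "card {a \<in> T. a < i} = Suc (card {a \<in> T - {k}. a < i})"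
      using assms(1) by simp
    then show ?thesis using True by (simp add: ksgn_def)
  next
    case False
    then have "{a \<in> T. a < i} = {a \<in> T - {k}. a < i}" using that by auto
    then show ?thesis using False by (simp add: ksgn_def)
  qed
  show ?thesis using rem[of j l] rem[of l j] assms by (cases "j < l") (auto simp: mult.commute)
qed

section \<open>Splitting off one generator\<close>

lemma join_linear:
  "join l a b - join l c d = join l (a - c) (b - d)"
  "join l a b + join l c d = join l (a + c) (b + d)"
  "r \<odot> join l a b = join l (r \<odot> a) (r \<odot> b)" "- join l a b = join l (- a) (- b)"
  by (auto simp: join_def fun_eq_iff algebra_simps)

lemma join_zero [simp]: "join l 0 0 = 0"
  by (auto simp: join_def fun_eq_iff)

lemma supp_joinE:
  assumes "supp (insert l J) c" "l \<notin> J"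
  obtains a b where "supp J a" "supp J b" "c = join l a b"
proof
  show "supp J (\<lambda>T. if l \<in> T then 0 else c T)"
    using assms by (auto simp: supp_def)
  show "supp J (\<lambda>T. if l \<in> T then 0 else ksgn l T * c (insert l T))"
    using assms by (auto simp: supp_def split: if_splits) (metis insertE insertCI mult_zero_right subsetD)
  show "c = join l (\<lambda>T. if l \<in> T then 0 else c T) (\<lambda>T. if l \<in> T then 0 else ksgn l T * c (insert l T))"
    by (auto simp: join_def fun_eq_iff insert_absorb)
qed

text \<open>A set containing l loses one element and the summand \<open>\<nu> l\<close> of its twist
  when l is deleted; this is the shift of the second component.\<close>

lemma Coch_join_iff:
  assumes "finite J" "l \<notin> J" "supp J a" "supp J b" "stable W"
  shows "join l a b \<in> Coch W (insert l J) \<nu> e p \<longleftrightarrow>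
    a \<in> Coch W J \<nu> e p \<and> b \<in> Coch W J \<nu> (e + int (\<nu> l)) (p - 1)"
proof
  assume j: "join l a b \<in> Coch W (insert l J) \<nu> e p"
  have J: "join l a b T \<noteq> 0 \<Longrightarrow> int (card T) = p" "join l a b T \<in> W (e + int (sum \<nu> T))" for T
    using j by (auto simp: Coch_def)
  have "(a T \<noteq> 0 \<longrightarrow> T \<subseteq> J \<and> int (card T) = p) \<and> a T \<in> W (e + int (sum \<nu> T))" for T
  proof (cases "a T = 0")
    case True
    then show ?thesis by (simp add: is_ideal_zero stable_ideal assms)
  next
    case False
    then have "T \<subseteq> J" using assms by (auto simp: supp_def)
    then show ?thesis using J[of T] False assms by (auto simp: join_def split: if_splits)
  qed
  moreover have "(b T \<noteq> 0 \<longrightarrow> T \<subseteq> J \<and> int (card T) = p - 1) \<and> b T \<in> W (e + int (\<nu> l) + int (sum \<nu> T))" for T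
  proof (cases "b T = 0")
    case True
    then show ?thesis by (simp add: is_ideal_zero stable_ideal assms)
  next
    case False
    then have "T \<subseteq> J" using assms by (auto simp: supp_def)
    then have T: "T \<subseteq> J" "finite T" "l \<notin> T" using finite_subset[OF _ assms(1)] assms(2) by auto
    then have eq: "join l a b (insert l T) = ksgn l (insert l T) * b T" by (simp add: join_def)
    then have b: "b T = ksgn l (insert l T) * join l a b (insert l T)" by simp
    then have "join l a b (insert l T) \<noteq> 0" using False by auto
    then have "int (card T) = p - 1" using J(1)[of "insert l T"] T by simp
    moreover have "b T \<in> W (e + int (\<nu> l) + int (sum \<nu> T))"
      using is_ideal_mult[OF stable_ideal[OF assms(5)] J(2)[of "insert l T"]] T b by (simp add: add.assoc)
    ultimately show ?thesis using T by simp
  qed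
  ultimately show "a \<in> Coch W J \<nu> e p \<and> b \<in> Coch W J \<nu> (e + int (\<nu> l)) (p - 1)"
    by (simp add: Coch_def)
next
  assume ab: "a \<in> Coch W J \<nu> e p \<and> b \<in> Coch W J \<nu> (e + int (\<nu> l)) (p - 1)"
  have "(join l a b T \<noteq> 0 \<longrightarrow> T \<subseteq> insert l J \<and> int (card T) = p) \<and> join l a b T \<in> W (e + int (sum \<nu> T))" for T
  proof (cases "l \<in> T \<and> b (T - {l}) \<noteq> 0")
    case True
    then have T: "T - {l} \<subseteq> J" "int (card (T - {l})) = p - 1" "b (T - {l}) \<in> W (e + int (\<nu> l) + int (sum \<nu> (T - {l})))"
      using ab by (auto simp: Coch_def)
    then have fT: "finite T" using finite_subset[OF _ assms(1)] by (metis finite_Diff2 finite.intros)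
    have "card T > 0" using True fT card_gt_0_iff by blast
    have "e + int (\<nu> l) + int (sum \<nu> (T - {l})) = e + int (sum \<nu> T)"
      using sum.remove[OF fT, of l \<nu>] True by simp
    then have "b (T - {l}) \<in> W (e + int (sum \<nu> T))" using T(3) by (metis add.assoc)
    then have "ksgn l T * b (T - {l}) \<in> W (e + int (sum \<nu> T))"
      by (rule is_ideal_mult[OF stable_ideal[OF assms(5)]])
    then show ?thesis
      using T True fT \<open>card T > 0\<close> by (auto simp: join_def)
  next
    case False
    then show ?thesis using ab by (auto simp: join_def Coch_def is_ideal_zero stable_ideal assms(5))
  qed
  then show "join l a b \<in> Coch W (insert l J) \<nu> e p" by (simp add: Coch_def)
qed

lemma Coch_joinE:
  assumes "c \<in> Coch W (insert l J) \<nu> e p" "finite J" "l \<notin> J" "stable W"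
  obtains a b where "a \<in> Coch W J \<nu> e p" "b \<in> Coch W J \<nu> (e + int (\<nu> l)) (p - 1)" "c = join l a b"
proof -
  obtain a b where "supp J a" "supp J b" "c = join l a b"
    using supp_joinE[OF Coch_supp[OF assms(1)] assms(3)] .
  then show ?thesis using that Coch_join_iff assms by metis
qed

text \<open>The Koszul complex on \<open>insert l J\<close> is the shifted mapping cone of
  \<open>x l ^ \<nu> l\<close> on the complex on J; the minus sign comes from moving e_j past
  e_l.\<close>

lemma D_join:
  assumes "finite J" "l \<notin> J" "supp J a" "supp J b"
  shows "D (insert l J) \<nu> (join l a b) = join l (D J \<nu> a) (x l ^ \<nu> l \<odot> a - D J \<nu> b)"
proof
  fix T
  show "D (insert l J) \<nu> (join l a b) T = join l (D J \<nu> a) (x l ^ \<nu> l \<odot> a - D J \<nu> b) T"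
  proof (cases "T \<subseteq> insert l J")
    case False
    then have *: "\<not> T \<subseteq> J" "\<not> T - {l} \<subseteq> J" by auto
    then have "a (T - {l}) = 0" using assms(3) by (auto simp: supp_def)
    with False * show ?thesis by (auto simp: D_def join_def)
  next
    case True
    then have fT: "finite T" using assms(1) finite_subset by (metis finite_insert)
    show ?thesis
    proof (cases "l \<in> T")
      case False
      then show ?thesis using True by (auto simp: D_def join_def intro!: sum.cong)
    next
      case l: True
      have "(\<Sum>j\<in>T - {l}. ksgn j T * x j ^ \<nu> j * join l a b (T - {j}))
          = (\<Sum>j\<in>T - {l}. - (ksgn l T * (ksgn j (T - {l}) * x j ^ \<nu> j * b (T - {l} - {j}))))"
      proof (rule sum.cong)
        fix j assume j: "j \<in> T - {l}"
        have "ksgn j T * x j ^ \<nu> j * join l a b (T - {j})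
            = (ksgn j T * ksgn l (T - {j})) * x j ^ \<nu> j * b (T - {j} - {l})"
          using j l by (simp add: join_def ac_simps)
        also have "\<dots> = - (ksgn l T * ksgn j (T - {l})) * x j ^ \<nu> j * b (T - {l} - {j})"
          unfolding ksgn_swap[OF fT _ l, of j, symmetric] using ksgn_swap[OF fT _ l, of j, where 'b='a] j
          by (simp add: Diff_insert2[symmetric] insert_commute[of l j])
        finally show "ksgn j T * x j ^ \<nu> j * join l a b (T - {j})
            = - (ksgn l T * (ksgn j (T - {l}) * x j ^ \<nu> j * b (T - {l} - {j})))"
          by (simp add: ac_simps)
      qed simp
      also have "\<dots> = - (ksgn l T * D J \<nu> b (T - {l}))"
        using True by (auto simp: D_def sum_distrib_left sum_negf)
      finally show ?thesis
        using True l sum.remove[OF fT l, of "\<lambda>j. ksgn j T * x j ^ \<nu> j * join l a b (T - {j})"]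
        by (simp add: D_def[of "insert l J"] join_def algebra_simps)
    qed
  qed
qed

lemma \<Phi>_join:
  assumes "finite J" "supp J b"
  shows "\<Phi> \<nu> \<mu> (join l a b) = join l (\<Phi> \<nu> \<mu> a) (x l ^ (\<mu> l - \<nu> l) \<odot> \<Phi> \<nu> \<mu> b)"
proof
  fix T
  show "\<Phi> \<nu> \<mu> (join l a b) T = join l (\<Phi> \<nu> \<mu> a) (x l ^ (\<mu> l - \<nu> l) \<odot> \<Phi> \<nu> \<mu> b) T"
  proof (cases "l \<in> T \<and> b (T - {l}) \<noteq> 0")
    case True
    then have "T - {l} \<subseteq> J" using assms by (auto simp: supp_def)
    then have "finite T" using finite_subset[OF _ assms(1)] by (metis finite_Diff2 finite.intros)
    with True show ?thesis
      using prod.remove[of T l "\<lambda>j. x j ^ (\<mu> j - \<nu> j)"] by (simp add: \<Phi>_def join_def ac_simps)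
  qed (auto simp: \<Phi>_def join_def)
qed

lemma supp_D: "supp J (D J \<nu> c)"
  by (auto simp: supp_def D_def)

lemma supp_\<Phi>: "supp J c \<Longrightarrow> supp J (\<Phi> \<nu> \<mu> c)"
  unfolding supp_def \<Phi>_def by (metis mult_zero_right)

lemma supp_linear:
  "supp J a \<Longrightarrow> supp J b \<Longrightarrow> supp J (a + b)" "supp J a \<Longrightarrow> supp J b \<Longrightarrow> supp J (a - b)"
  "supp J a \<Longrightarrow> supp J (r \<odot> a)" "supp J a \<Longrightarrow> supp J (- a)" "supp J 0"
  unfolding supp_def plus_fun_apply minus_apply scal_apply uminus_apply zero_fun_apply
  by (metis add.right_neutral, metis diff_0_right, metis mult_zero_right, metis neg_0_equal_iff_equal, metis)

lemmas supp_intros = supp_D supp_\<Phi> supp_linear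

text \<open>In cone form the two copies of \<open>x l ^ \<nu> l\<close> times D a cancel, which
  reduces the claim to J.\<close>

lemma D_D:
  assumes "finite J"
  shows "supp J c \<Longrightarrow> D J \<nu> (D J \<nu> c) = 0"
  using assms
proof (induction J arbitrary: c rule: finite_induct)
  case empty
  show ?case by (auto simp: D_def fun_eq_iff)
next
  case (insert l J)
  obtain a b where ab: "supp J a" "supp J b" "c = join l a b"
    using supp_joinE[OF insert.prems insert.hyps(2)] .
  have "D (insert l J) \<nu> (D (insert l J) \<nu> c)
      = join l (D J \<nu> (D J \<nu> a)) (x l ^ \<nu> l \<odot> D J \<nu> a - (x l ^ \<nu> l \<odot> D J \<nu> a - D J \<nu> (D J \<nu> b)))"
    using ab insert.hyps by (simp add: D_join supp_intros D_linear)
  also have "\<dots> = 0"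
    unfolding insert.IH[OF ab(1)] insert.IH[OF ab(2)] diff_zero diff_self join_zero ..
  finally show ?case .
qed


end

section \<open>Exponents of the generators\<close>

text \<open>The graded module under consideration has components \<^term>\<open>U e\<close> modulo \<^term>\<open>V e\<close>. Cohomological
  degrees are integers, so that the degree \<open>p - 1\<close> cochains are zero for \<open>p = 0\<close>.\<close>
locale graded_koszul = koszul x m for x :: "nat \<Rightarrow> 'a::comm_ring_1" and m +
  fixes U V :: "int \<Rightarrow> 'a set"
  assumes stable_U: "stable U" and stable_V: "stable V"
begin

definition cocyc :: "(nat \<Rightarrow> nat) \<Rightarrow> int \<Rightarrow> int \<Rightarrow> (nat set \<Rightarrow> 'a) \<Rightarrow> bool" where
  "cocyc \<nu> e p z \<longleftrightarrow> z \<in> Coch U {..<m} \<nu> e p \<and> D {..<m} \<nu> z \<in> Coch V {..<m} \<nu> e (p + 1)"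

definition cobd :: "(nat \<Rightarrow> nat) \<Rightarrow> int \<Rightarrow> int \<Rightarrow> (nat set \<Rightarrow> 'a) \<Rightarrow> bool" where
  "cobd \<nu> e p z \<longleftrightarrow> (\<exists>b\<in>Coch U {..<m} \<nu> e (p - 1). z - D {..<m} \<nu> b \<in> Coch V {..<m} \<nu> e p)"

text \<open>The complexes with exponents \<^term>\<open>vec l n\<close> form a direct system in \<^term>\<open>n\<close>, in which
  the first \<^term>\<open>l\<close> variables keep the exponent 1. The case \<^term>\<open>l = 0\<close> yields local cohomology,
  the case \<^term>\<open>l = m\<close> Koszul cohomology.\<close>
definition vec :: "nat \<Rightarrow> nat \<Rightarrow> nat \<Rightarrow> nat" where
  "vec l n j = (if j < l then 1 else n)"

text \<open>Vanishing of the colimit of the cohomology groups in degree e, expressed elementwise: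
  every class dies at some later stage.\<close>

definition vanish :: "nat \<Rightarrow> int \<Rightarrow> int \<Rightarrow> bool" where
  "vanish l p e \<longleftrightarrow> (\<forall>n\<ge>1. \<forall>z. cocyc (vec l n) e p z \<longrightarrow>
     (\<exists>N\<ge>n. cobd (vec l N) e p (\<Phi> (vec l n) (vec l N) z)))"

lemma vec_simps [simp]: "vec l n l = n" "vec (Suc l) n l = 1"
  "j \<noteq> l \<Longrightarrow> vec (Suc l) n j = vec l n j" "vec 0 n = (\<lambda>_. n)"
  by (auto simp: vec_def)

lemma vec_mono: "1 \<le> n \<Longrightarrow> n \<le> N \<Longrightarrow> l \<le> k \<Longrightarrow> vec k n j \<le> vec l N j"
  by (auto simp: vec_def)

lemmas UV_linear = Coch_zero[OF stable_U] Coch_add[OF stable_U] Coch_diff[OF stable_U]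
  Coch_uminus[OF stable_U] Coch_scal[OF stable_U]
  Coch_zero[OF stable_V] Coch_add[OF stable_V] Coch_diff[OF stable_V]
  Coch_uminus[OF stable_V] Coch_scal[OF stable_V]

lemma U_D: "J \<subseteq> {..<m} \<Longrightarrow> c \<in> Coch U J \<nu> e (p - 1) \<Longrightarrow> D J \<nu> c \<in> Coch U J \<nu> e p"
  using D_Coch[OF stable_U, of J c \<nu> e "p - 1"] by simp

lemma cocyc_\<Phi>:
  assumes "cocyc \<nu> e p z" "\<And>j. j < m \<Longrightarrow> \<nu> j \<le> \<mu> j"
  shows "cocyc \<mu> e p (\<Phi> \<nu> \<mu> z)"
  using assms \<Phi>_D[of "{..<m}" \<nu> \<mu>] \<Phi>_Coch[OF stable_U, of "{..<m}" \<nu> \<mu>] \<Phi>_Coch[OF stable_V, of "{..<m}" \<nu> \<mu>]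
  by (simp add: cocyc_def)

lemma cobd_\<Phi>:
  assumes "cobd \<nu> e p z" "\<And>j. j < m \<Longrightarrow> \<nu> j \<le> \<mu> j"
  shows "cobd \<mu> e p (\<Phi> \<nu> \<mu> z)"
proof -
  obtain b where b: "b \<in> Coch U {..<m} \<nu> e (p - 1)" "z - D {..<m} \<nu> b \<in> Coch V {..<m} \<nu> e p"
    using assms(1) by (auto simp: cobd_def)
  have "\<Phi> \<nu> \<mu> (z - D {..<m} \<nu> b) \<in> Coch V {..<m} \<mu> e p"
    using \<Phi>_Coch[OF stable_V _ _ b(2)] assms(2) by simp
  moreover have "\<Phi> \<nu> \<mu> (D {..<m} \<nu> b) = D {..<m} \<mu> (\<Phi> \<nu> \<mu> b)"
    by (rule \<Phi>_D[symmetric]) (use assms(2) in auto)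
  ultimately show ?thesis
    unfolding cobd_def using \<Phi>_Coch[OF stable_U _ _ b(1), of \<mu>] assms(2)
    by (intro bexI[of _ "\<Phi> \<nu> \<mu> b"]) (simp_all add: \<Phi>_linear)
qed

lemma cobd_add: "cobd \<nu> e p y \<Longrightarrow> cobd \<nu> e p z \<Longrightarrow> cobd \<nu> e p (y + z)"
proof -
  assume "cobd \<nu> e p y" "cobd \<nu> e p z"
  then obtain b c where "b \<in> Coch U {..<m} \<nu> e (p - 1)" "y - D {..<m} \<nu> b \<in> Coch V {..<m} \<nu> e p"
    "c \<in> Coch U {..<m} \<nu> e (p - 1)" "z - D {..<m} \<nu> c \<in> Coch V {..<m} \<nu> e p"
    by (auto simp: cobd_def)
  moreover have "y + z - D {..<m} \<nu> (b + c) = (y - D {..<m} \<nu> b) + (z - D {..<m} \<nu> c)"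
    by (simp add: D_linear)
  ultimately show ?thesis
    unfolding cobd_def using UV_linear by metis
qed

section \<open>Cocycles and coboundaries as pairs\<close>

context
  fixes l J and \<mu> :: "nat \<Rightarrow> nat" assumes l: "l < m" and J: "J = {..<m} - {l}"
begin

lemma J_facts: "finite J" "l \<notin> J" "insert l J = {..<m}" "J \<subseteq> {..<m}"
  using l J by auto

lemma Coch_J_cong: "(\<And>j. j \<noteq> l \<Longrightarrow> \<nu> j = \<mu> j) \<Longrightarrow> stable W \<Longrightarrow> Coch W J \<nu> e p = Coch W J \<mu> e p"
  using Coch_cong[of W J \<nu> \<mu>] stable_ideal is_ideal_zero J_facts(2) by metis

lemma D_J_cong: "(\<And>j. j \<noteq> l \<Longrightarrow> \<nu> j = \<mu> j) \<Longrightarrow> D J \<nu> = D J \<mu>"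
  using D_cong[of J \<nu> \<mu>] J_facts(2) by metis

text \<open>The exponent at l enters only through the cone map and the shift. The complexes on J are
  therefore written with a common \<mu>, so that exponent families differing only at l can be
  compared.\<close>

lemma cocyc_join_iff:
  assumes "supp J a" "supp J b" "\<And>j. j \<noteq> l \<Longrightarrow> \<nu> j = \<mu> j"
  shows "cocyc \<nu> e p (join l a b) \<longleftrightarrow>
    a \<in> Coch U J \<mu> e p \<and> b \<in> Coch U J \<mu> (e + int (\<nu> l)) (p - 1) \<and>
    D J \<mu> a \<in> Coch V J \<mu> e (p + 1) \<and> x l ^ \<nu> l \<odot> a - D J \<mu> b \<in> Coch V J \<mu> (e + int (\<nu> l)) p"
  unfolding cocyc_def J_facts(3)[symmetric] D_join[OF J_facts(1,2) assms(1,2)]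
  using Coch_join_iff[OF J_facts(1,2), where W=U and \<nu>=\<nu>] Coch_join_iff[OF J_facts(1,2), where W=V and \<nu>=\<nu>]
    assms stable_U stable_V
  by (simp add: supp_intros Coch_J_cong[OF assms(3)] D_J_cong[OF assms(3)] conj_assoc)

lemma cobd_join_iff:
  assumes "supp J a" "supp J b" "\<And>j. j \<noteq> l \<Longrightarrow> \<nu> j = \<mu> j"
  shows "cobd \<nu> e p (join l a b) \<longleftrightarrow>
    (\<exists>c\<in>Coch U J \<mu> e (p - 1). \<exists>d\<in>Coch U J \<mu> (e + int (\<nu> l)) (p - 2).
      a - D J \<mu> c \<in> Coch V J \<mu> e p \<and>
      b - (x l ^ \<nu> l \<odot> c - D J \<mu> d) \<in> Coch V J \<mu> (e + int (\<nu> l)) (p - 1))"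
proof -
  have *: "join l a b - D (insert l J) \<nu> (join l c d) \<in> Coch V (insert l J) \<nu> e p \<longleftrightarrow>
      a - D J \<mu> c \<in> Coch V J \<mu> e p \<and>
      b - (x l ^ \<nu> l \<odot> c - D J \<mu> d) \<in> Coch V J \<mu> (e + int (\<nu> l)) (p - 1)"
    if "supp J c" "supp J d" for c d
    using that assms stable_V
    by (simp add: D_join[OF J_facts(1,2)] join_linear Coch_join_iff[OF J_facts(1,2)] supp_intros
        Coch_J_cong[OF assms(3)] D_J_cong[OF assms(3)])
  show ?thesis
    unfolding cobd_def J_facts(3)[symmetric]
  proof safe
    fix b' assume b': "b' \<in> Coch U (insert l J) \<nu> e (p - 1)"
      "join l a b - D (insert l J) \<nu> b' \<in> Coch V (insert l J) \<nu> e p"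
    obtain c d where cd: "c \<in> Coch U J \<nu> e (p - 1)" "d \<in> Coch U J \<nu> (e + int (\<nu> l)) (p - 1 - 1)" "b' = join l c d"
      using Coch_joinE[OF b'(1) J_facts(1,2) stable_U] .
    then show "\<exists>c\<in>Coch U J \<mu> e (p - 1). \<exists>d\<in>Coch U J \<mu> (e + int (\<nu> l)) (p - 2).
      a - D J \<mu> c \<in> Coch V J \<mu> e p \<and>
      b - (x l ^ \<nu> l \<odot> c - D J \<mu> d) \<in> Coch V J \<mu> (e + int (\<nu> l)) (p - 1)"
      using b'(2) *[of c d] by (auto simp: Coch_J_cong[OF assms(3)] stable_U dest: Coch_supp)
  next
    fix c d assume cd: "c \<in> Coch U J \<mu> e (p - 1)" "d \<in> Coch U J \<mu> (e + int (\<nu> l)) (p - 2)"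
      "a - D J \<mu> c \<in> Coch V J \<mu> e p"
      "b - (x l ^ \<nu> l \<odot> c - D J \<mu> d) \<in> Coch V J \<mu> (e + int (\<nu> l)) (p - 1)"
    then have s: "supp J c" "supp J d" by (auto dest: Coch_supp)
    then have "join l c d \<in> Coch U (insert l J) \<nu> e (p - 1)"
      using cd Coch_join_iff[OF J_facts(1,2) s stable_U] by (simp add: Coch_J_cong[OF assms(3)] stable_U)
    then show "\<exists>b'\<in>Coch U (insert l J) \<nu> e (p - 1).
        join l a b - D (insert l J) \<nu> b' \<in> Coch V (insert l J) \<nu> e p"
      using *[OF s] cd by blast
  qed
qed

lemma cocyc_joinE:
  assumes "cocyc \<nu> e p z"
  obtains a b where "supp J a" "supp J b" "z = join l a b"
proof -
  have "supp (insert l J) z" using assms J_facts(3) by (auto simp: cocyc_def intro: Coch_supp)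
  then show ?thesis using that by (rule supp_joinE[OF _ J_facts(2)])
qed

lemma \<Phi>_join_J:
  assumes "supp J a" "supp J b" "\<And>j. j \<noteq> l \<Longrightarrow> \<nu> j = \<mu> j \<and> \<nu>' j = \<mu>' j"
  shows "\<Phi> \<nu> \<nu>' (join l a b) = join l (\<Phi> \<mu> \<mu>' a) (x l ^ (\<nu>' l - \<nu> l) \<odot> \<Phi> \<mu> \<mu>' b)"
proof -
  have "\<And>j. j \<in> J \<Longrightarrow> \<nu> j = \<mu> j" "\<And>j. j \<in> J \<Longrightarrow> \<nu>' j = \<mu>' j"
    using assms(3) J_facts(2) by metis+
  then have "\<Phi> \<nu> \<nu>' c = \<Phi> \<mu> \<mu>' c" if "supp J c" for c
    by (intro \<Phi>_cong[OF that]) blast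
  then show ?thesis
    using \<Phi>_join[OF J_facts(1) assms(2)] assms(1,2) by simp
qed

end

text \<open>The exponent of one variable is increased along the composition of multiplication by
  \<^term>\<open>x l\<close> and by \<^term>\<open>x l ^ n\<close>.\<close>
lemma cobd_exponent_Suc:
  assumes l: "l < m"
    and one: "\<And>e z. e \<ge> e0 \<Longrightarrow> cocyc (\<nu>(l := 1)) e p z \<Longrightarrow> cobd (\<nu>(l := 1)) e p z"
    and n: "\<And>e z. e \<ge> e0 \<Longrightarrow> cocyc (\<nu>(l := n)) e p z \<Longrightarrow> cobd (\<nu>(l := n)) e p z"
    and e: "e \<ge> e0" and z: "cocyc (\<nu>(l := Suc n)) e p z"
  shows "cobd (\<nu>(l := Suc n)) e p z"
proof -
  define J where J: "J = {..<m} - {l}"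
  note iff = cocyc_join_iff[OF l J, where \<mu>=\<nu>] cobd_join_iff[OF l J, where \<mu>=\<nu>]
  note J' = J_facts[OF l J]
  obtain a b where ab: "supp J a" "supp J b" "z = join l a b"
    using cocyc_joinE[OF l J z] .
  have a: "a \<in> Coch U J \<nu> e p" "b \<in> Coch U J \<nu> (e + int (Suc n)) (p - 1)"
    "D J \<nu> a \<in> Coch V J \<nu> e (p + 1)" "x l ^ Suc n \<odot> a - D J \<nu> b \<in> Coch V J \<nu> (e + int (Suc n)) p"
    using z unfolding ab(3) by (simp_all add: iff ab)
  \<comment> \<open>As \<open>x l ^ n\<close> times (x l a) agrees with D b modulo V, moving one
    factor x l into the first component gives a cocycle for exponent n, one degree higher.\<close>
  have "cocyc (\<nu>(l := n)) (e + 1) p (join l (x l \<odot> a) b)"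
    using a Coch_x[OF stable_U l a(1)] Coch_x[OF stable_V l a(3)]
    by (simp add: iff ab supp_intros D_linear power_commutes ac_simps)
  then have "cobd (\<nu>(l := n)) (e + 1) p (join l (x l \<odot> a) b)"
    using n e by simp
  then obtain c d where cd: "c \<in> Coch U J \<nu> (e + 1) (p - 1)" "d \<in> Coch U J \<nu> (e + 1 + int n) (p - 2)"
    "x l \<odot> a - D J \<nu> c \<in> Coch V J \<nu> (e + 1) p"
    "b - (x l ^ n \<odot> c - D J \<nu> d) \<in> Coch V J \<nu> (e + 1 + int n) (p - 1)"
    by (auto simp: iff ab supp_intros)
  \<comment> \<open>The primitive c of x l a is the second component of a cocycle for exponent 1, in
    the original degree e.\<close>
  have "cocyc (\<nu>(l := 1)) e p (join l a c)"
    using a cd Coch_supp[OF cd(1)] by (simp add: iff ab)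
  then have "cobd (\<nu>(l := 1)) e p (join l a c)"
    using one e by simp
  then obtain f g where fg: "f \<in> Coch U J \<nu> e (p - 1)" "g \<in> Coch U J \<nu> (e + 1) (p - 2)"
    "a - D J \<nu> f \<in> Coch V J \<nu> e p" "c - (x l \<odot> f - D J \<nu> g) \<in> Coch V J \<nu> (e + 1) (p - 1)"
    using Coch_supp[OF cd(1)] by (auto simp: iff ab)
  have "x l ^ n \<odot> (c - (x l \<odot> f - D J \<nu> g)) + (b - (x l ^ n \<odot> c - D J \<nu> d))
      \<in> Coch V J \<nu> (e + 1 + int n) (p - 1)"
    using UV_linear(7) Coch_power[OF stable_V l fg(4)] cd(4) by blast
  also have "x l ^ n \<odot> (c - (x l \<odot> f - D J \<nu> g)) + (b - (x l ^ n \<odot> c - D J \<nu> d)) =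
      b - (x l ^ Suc n \<odot> f - D J \<nu> (x l ^ n \<odot> g + d))"
    by (simp add: D_linear scal_distrib power_commutes algebra_simps)
  finally have "b - (x l ^ Suc n \<odot> f - D J \<nu> (x l ^ n \<odot> g + d)) \<in> Coch V J \<nu> (e + 1 + int n) (p - 1)" .
  then have h: "b - (x l ^ Suc n \<odot> f - D J \<nu> (x l ^ n \<odot> g + d)) \<in> Coch V J \<nu> (e + int (Suc n)) (p - 1)"
    by (simp add: ac_simps)
  have "x l ^ n \<odot> g + d \<in> Coch U J \<nu> (e + int (Suc n)) (p - 2)"
    using UV_linear(2) Coch_power[OF stable_U l fg(2)] cd(2) by (simp add: ac_simps)
  then show ?thesis
    using fg h unfolding ab(3) by (auto simp: iff ab)
qed

text \<open>Raising the exponent by one refers only to the degrees e and e + 1, so the bound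
  \<open>e0\<close> is the same for all n.\<close>

lemma cobd_exponent:
  assumes "l < m" "\<nu> l = 1"
    and "\<And>e z. e \<ge> e0 \<Longrightarrow> cocyc \<nu> e p z \<Longrightarrow> cobd \<nu> e p z"
    and "n \<ge> 1" "e \<ge> e0" "cocyc (\<nu>(l := n)) e p z"
  shows "cobd (\<nu>(l := n)) e p z"
  using assms(4-6)
proof (induction n arbitrary: e z rule: dec_induct)
  case base
  then show ?case using assms(2,3) by (metis fun_upd_triv)
next
  case (step n)
  have one: "\<nu>(l := 1) = \<nu>" using assms(2) by auto
  show ?case
  proof (rule cobd_exponent_Suc[OF assms(1)])
    show "cobd (\<nu>(l := 1)) e p z" if "e0 \<le> e" "cocyc (\<nu>(l := 1)) e p z" for e z
      using that assms(3) unfolding one by blast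
  qed (fact step.IH step.prems)+
qed

text \<open>The exponents are changed from 1 to n one generator at a time with the same
  \<open>e0\<close>. Every cocycle is then a coboundary at its own stage, and N = n serves in the
  colimit.\<close>

lemma vanish_from_ones:
  assumes "\<And>e z. e \<ge> e0 \<Longrightarrow> cocyc (\<lambda>_. 1) e p z \<Longrightarrow> cobd (\<lambda>_. 1) e p z" and "e \<ge> e0"
  shows "vanish 0 p e"
proof -
  have "cobd (\<lambda>j. if j < l then n else 1) e p z"
    if "n \<ge> 1" "l \<le> m" "e \<ge> e0" "cocyc (\<lambda>j. if j < l then n else 1) e p z" for n l e z
    using that
  proof (induction l arbitrary: e z)
    case 0
    then show ?case using assms(1) by simp
  next
    case (Suc l)
    have eq: "(\<lambda>j. if j < Suc l then n else 1) = (\<lambda>j. if j < l then n else 1)(l := n)" by auto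
    show ?case
      unfolding eq
      by (rule cobd_exponent[of l _ e0]) (use Suc eq in auto)
  qed
  note * = this[of _ m]
  have "cobd (\<lambda>_. n) e p z" if "n \<ge> 1" "cocyc (\<lambda>_. n) e p z" for n z
  proof -
    have c: "Coch W {..<m} (\<lambda>_. n) = Coch W {..<m} (\<lambda>j. if j < m then n else 1)" if "stable W" for W
      using Coch_cong[of W "{..<m}" "\<lambda>_. n" "\<lambda>j. if j < m then n else 1"] that
      by (auto simp: stable_ideal is_ideal_zero fun_eq_iff)
    have d: "D {..<m} (\<lambda>_. n) = D {..<m} (\<lambda>j. if j < m then n else 1)"
      by (rule D_cong) auto
    show ?thesis
      using *[of n e z] that assms(2)
      by (simp add: cobd_def cocyc_def c[OF stable_U] c[OF stable_V] d)
  qed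
  then show ?thesis by (auto simp: vanish_def intro!: exI[of _ n for n])
qed

text \<open>Koszul cohomology with respect to \<open>x l\<close> is unchanged when the module is
  replaced by its derived sections supported on \<open>x l\<close>. Hence H(l+1)^p_e lies in an
  exact sequence between H(l)^(p-1)_(e+1) and H(l)^p_e; the proof is the diagram chase on
  cochains.\<close>

lemma vanish_Suc:
  assumes l: "l < m" and p: "vanish l p e" and p1: "vanish l (p - 1) (e + 1)"
  shows "vanish (Suc l) p e"
  unfolding vanish_def
proof (intro allI impI)
  fix n z assume n: "n \<ge> 1" and z: "cocyc (vec (Suc l) n) e p z"
  define J where J: "J = {..<m} - {l}"
  note cocyc_iff = cocyc_join_iff[OF l J] and cobd_iff = cobd_join_iff[OF l J]
  note \<Phi>J = \<Phi>_join_J[OF l J]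
  note J' = J_facts[OF l J]
  obtain a b where ab: "supp J a" "supp J b" "z = join l a b"
    using cocyc_joinE[OF l J z] .
  have a: "a \<in> Coch U J (vec l n) e p" "b \<in> Coch U J (vec l n) (e + 1) (p - 1)"
    "D J (vec l n) a \<in> Coch V J (vec l n) e (p + 1)"
    "x l \<odot> a - D J (vec l n) b \<in> Coch V J (vec l n) (e + 1) p"
    using z unfolding ab(3) by (simp_all add: cocyc_iff[where \<mu>="vec l n"] cobd_iff[where \<mu>="vec l n"] ab)
  have "cocyc (vec l n) e p (\<Phi> (vec (Suc l) n) (vec l n) z)"
    using z n by (intro cocyc_\<Phi> vec_mono) auto
  then obtain N where N: "N \<ge> n" "cobd (vec l N) e p (\<Phi> (vec l n) (vec l N) (\<Phi> (vec (Suc l) n) (vec l n) z))"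
    using p n by (auto simp: vanish_def)
  let ?\<Phi> = "\<Phi> (vec l n) (vec l N)" and ?D = "D J (vec l N)" and ?C = "\<lambda>W. Coch W J (vec l N)"
  have z1: "\<Phi> (vec l n) (vec l N) (\<Phi> (vec (Suc l) n) (vec l n) z) = join l (?\<Phi> a) (x l ^ (N - 1) \<odot> ?\<Phi> b)"
    unfolding ab(3) using n N(1)
    by (simp add: \<Phi>J[where \<mu>="vec l n" and \<mu>'="vec l n"] \<Phi>J[where \<mu>="vec l n" and \<mu>'="vec l N"] ab supp_intros \<Phi>_linear power_add[symmetric])
  obtain c d where cd: "c \<in> ?C U e (p - 1)" "d \<in> ?C U (e + int N) (p - 2)"
    "?\<Phi> a - ?D c \<in> ?C V e p"
    "x l ^ (N - 1) \<odot> ?\<Phi> b - (x l ^ N \<odot> c - ?D d) \<in> ?C V (e + int N) (p - 1)"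
    using N(2) unfolding z1 by (auto simp: cocyc_iff[where \<mu>="vec l N"] cobd_iff[where \<mu>="vec l N"] ab supp_intros)
  \<comment> \<open>Modulo V, x l c and b have the same image under D, so \<beta> is a cocycle: it
    represents the part of the class coming from H(l)^(p-1)_(e+1). The relation for d shows that
    \<open>x l ^ N\<close> times \<beta> is a coboundary, which completes \<beta> to a cocycle of
    the cone.\<close>
  define \<beta> where "\<beta> = ?\<Phi> b - x l \<odot> c"
  have mono: "\<And>j. j \<in> J \<Longrightarrow> vec l n j \<le> vec l N j"
    using vec_mono n N by simp
  have \<Phi>C: "?\<Phi> w \<in> ?C W e' p'" if "stable W" "w \<in> Coch W J (vec l n) e' p'" for W w e' p'
    by (rule \<Phi>_Coch[OF that(1) J'(4) mono that(2)])
  have \<Phi>D: "?D (?\<Phi> w) = ?\<Phi> (D J (vec l n) w)" for w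
    using \<Phi>_D[OF J'(1)] mono by blast
  have \<Phi>b: "?\<Phi> b \<in> ?C U (e + 1) (p - 1)"
    using \<Phi>C[OF stable_U] a(2) by blast
  have \<beta>: "\<beta> \<in> ?C U (e + 1) (p - 1)"
    unfolding \<beta>_def using UV_linear(3) \<Phi>b Coch_x[OF stable_U l cd(1)] by blast
  have "x l \<odot> (?\<Phi> a - ?D c) - ?\<Phi> (x l \<odot> a - D J (vec l n) b) \<in> ?C V (e + 1) p"
    using UV_linear(8) Coch_x[OF stable_V l cd(3)] \<Phi>C[OF stable_V a(4)] by blast
  also have "x l \<odot> (?\<Phi> a - ?D c) - ?\<Phi> (x l \<odot> a - D J (vec l n) b) = ?D \<beta>"
    by (simp add: \<beta>_def \<Phi>_linear D_linear \<Phi>D scal_distrib)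
  finally have D\<beta>: "?D \<beta> \<in> ?C V (e + 1) p" .
  have "x l \<odot> (x l ^ (N - 1) \<odot> ?\<Phi> b - (x l ^ N \<odot> c - ?D d)) \<in> ?C V (e + 1 + int N) (p - 1)"
    using Coch_x[OF stable_V l cd(4)] by (simp add: ac_simps)
  also have "x l \<odot> (x l ^ (N - 1) \<odot> ?\<Phi> b - (x l ^ N \<odot> c - ?D d)) = x l ^ N \<odot> \<beta> - ?D (- (x l \<odot> d))"
    using n N(1) by (simp add: \<beta>_def D_linear scal_distrib power_minus_mult power_commutes
        flip: power_Suc)
  finally have "x l ^ N \<odot> \<beta> - ?D (- (x l \<odot> d)) \<in> ?C V (e + 1 + int N) (p - 1)" .
  then have "cocyc (vec l N) (e + 1) (p - 1) (join l \<beta> (- (x l \<odot> d)))"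
    using \<beta> D\<beta> Coch_x[OF stable_U l cd(2)]
    by (simp add: cocyc_iff[where \<mu>="vec l N"] cobd_iff[where \<mu>="vec l N"] supp_intros Coch_supp[OF \<beta>] Coch_supp[OF cd(2)] UV_linear ac_simps)
  then obtain N' where N': "N' \<ge> N" "cobd (vec l N') (e + 1) (p - 1) (\<Phi> (vec l N) (vec l N') (join l \<beta> (- (x l \<odot> d))))"
    using p1[unfolded vanish_def, rule_format, of N] n N(1) by auto
  let ?\<Phi>' = "\<Phi> (vec l N) (vec l N')" and ?D' = "D J (vec l N')" and ?C' = "\<lambda>W. Coch W J (vec l N')"
  \<comment> \<open>The first component of the coboundary relation supplies a primitive f of
    \<beta>; together with c it yields a primitive of the original cocycle with exponent 1 at
    l.\<close>
  obtain f where f: "f \<in> ?C' U (e + 1) (p - 2)" "?\<Phi>' \<beta> - ?D' f \<in> ?C' V (e + 1) (p - 1)"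
    using N'(2) by (auto simp: cocyc_iff[where \<mu>="vec l N'"] cobd_iff[where \<mu>="vec l N'"] \<Phi>J[where \<mu>="vec l N" and \<mu>'="vec l N'"] supp_intros Coch_supp[OF \<beta>] Coch_supp[OF cd(2)])
  have mono': "\<And>j. j \<in> J \<Longrightarrow> vec l N j \<le> vec l N' j"
    using vec_mono n N N' by simp
  have \<Phi>C': "?\<Phi>' w \<in> ?C' W e' p'" if "stable W" "w \<in> ?C W e' p'" for W w e' p'
    by (rule \<Phi>_Coch[OF that(1) J'(4) mono' that(2)])
  have \<Phi>D': "?D' (?\<Phi>' w) = ?\<Phi>' (?D w)" for w
    using \<Phi>_D[OF J'(1)] mono' by blast
  have comp: "\<Phi> (vec l n) (vec l N') w = ?\<Phi>' (?\<Phi> w)" if "supp J w" for w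
    using \<Phi>_comp[OF that] mono mono' by simp
  have 1: "?\<Phi>' (?\<Phi> a) - ?D' (?\<Phi>' c) \<in> ?C' V e p"
    using \<Phi>C'[OF stable_V cd(3)] by (simp add: \<Phi>D' \<Phi>_linear)
  have "?\<Phi>' \<beta> - ?D' f = ?\<Phi>' (?\<Phi> b) - (x l \<odot> ?\<Phi>' c - ?D' (- f))"
    by (simp add: \<beta>_def \<Phi>_linear D_linear algebra_simps)
  with f(2) have 2: "?\<Phi>' (?\<Phi> b) - (x l \<odot> ?\<Phi>' c - ?D' (- f)) \<in> ?C' V (e + 1) (p - 1)"
    by simp
  have "cobd (vec (Suc l) N') e p (join l (?\<Phi>' (?\<Phi> a)) (?\<Phi>' (?\<Phi> b)))"
    using 1 2 \<Phi>C'[OF stable_U cd(1)] UV_linear(4)[OF f(1)]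
      cobd_iff[of "?\<Phi>' (?\<Phi> a)" "?\<Phi>' (?\<Phi> b)" "vec (Suc l) N'" "vec l N'" e p]
    by (auto simp: supp_intros ab)
  then have "cobd (vec (Suc l) N') e p (\<Phi> (vec (Suc l) n) (vec (Suc l) N') z)"
    unfolding ab(3) by (simp add: \<Phi>J[where \<mu>="vec l n" and \<mu>'="vec l N'"] ab comp)
  then show "\<exists>N\<ge>n. cobd (vec (Suc l) N) e p (\<Phi> (vec (Suc l) n) (vec (Suc l) N) z)"
    using N(1) N'(1) le_trans by blast
qed

text \<open>In the same exact sequence the cokernel of H(l+1)^p_e -> H(l)^p_e embeds by
  multiplication with \<open>x l\<close> into H(l)^p_(e+1), which is zero by assumption.\<close>

lemma surj_Suc:
  assumes l: "l < m" and van: "vanish l p (e + 1)" and n: "n \<ge> 1" and z: "cocyc (vec l n) e p z"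
  shows "\<exists>N\<ge>n. \<exists>w. cocyc (vec (Suc l) N) e p w \<and>
    cobd (vec l N) e p (\<Phi> (vec (Suc l) N) (vec l N) w - \<Phi> (vec l n) (vec l N) z)"
proof -
  define J where J: "J = {..<m} - {l}"
  note cocyc_iff = cocyc_join_iff[OF l J] and cobd_iff = cobd_join_iff[OF l J]
  note \<Phi>J = \<Phi>_join_J[OF l J]
  note J' = J_facts[OF l J]
  obtain a b where ab: "supp J a" "supp J b" "z = join l a b"
    using cocyc_joinE[OF l J z] .
  have a: "a \<in> Coch U J (vec l n) e p" "b \<in> Coch U J (vec l n) (e + int n) (p - 1)"
    "D J (vec l n) a \<in> Coch V J (vec l n) e (p + 1)"
    "x l ^ n \<odot> a - D J (vec l n) b \<in> Coch V J (vec l n) (e + int n) p"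
    using z unfolding ab(3) by (simp_all add: cocyc_iff[where \<mu>="vec l n"] cobd_iff[where \<mu>="vec l n"] ab)
  have "cocyc (vec l n) (e + 1) p (x l \<odot> z)"
    using z Coch_x[OF stable_U l, of z] Coch_x[OF stable_V l, of "D {..<m} (vec l n) z"]
    by (simp add: cocyc_def D_linear)
  then obtain N where N: "N \<ge> n" "cobd (vec l N) (e + 1) p (\<Phi> (vec l n) (vec l N) (x l \<odot> z))"
    using van n by (auto simp: vanish_def)
  let ?\<Phi> = "\<Phi> (vec l n) (vec l N)" and ?D = "D J (vec l N)" and ?C = "\<lambda>W. Coch W J (vec l N)"
  have mono: "\<And>j. j \<in> J \<Longrightarrow> vec l n j \<le> vec l N j"
    using vec_mono n N by simp
  have \<Phi>C: "?\<Phi> w \<in> ?C W e' p'" if "stable W" "w \<in> Coch W J (vec l n) e' p'" for W w e' p'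
    by (rule \<Phi>_Coch[OF that(1) J'(4) mono that(2)])
  have \<Phi>D: "?D (?\<Phi> w) = ?\<Phi> (D J (vec l n) w)" for w
    using \<Phi>_D[OF J'(1)] mono by blast
  have z1: "\<Phi> (vec l n) (vec l N) (x l \<odot> z) = join l (x l \<odot> ?\<Phi> a) (x l ^ Suc (N - n) \<odot> ?\<Phi> b)"
    unfolding ab(3) by (simp add: \<Phi>J[where \<mu>="vec l n" and \<mu>'="vec l N"] ab supp_intros \<Phi>_linear join_linear mult.commute)
  obtain c d where cd: "c \<in> ?C U (e + 1) (p - 1)" "d \<in> ?C U (e + 1 + int N) (p - 2)"
    "x l \<odot> ?\<Phi> a - ?D c \<in> ?C V (e + 1) p"
    "x l ^ Suc (N - n) \<odot> ?\<Phi> b - (x l ^ N \<odot> c - ?D d) \<in> ?C V (e + 1 + int N) (p - 1)"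
    using N(2) unfolding z1 by (auto simp: cocyc_iff[where \<mu>="vec l N"] cobd_iff[where \<mu>="vec l N"] ab supp_intros simp del: power_Suc)
  \<comment> \<open>The cochain c bounding x l a replaces b: paired with a it is a cocycle with
    exponent 1 at l.\<close>
  have w: "cocyc (vec (Suc l) N) e p (join l (?\<Phi> a) c)"
    using cd \<Phi>C[OF stable_U a(1)] \<Phi>C[OF stable_V a(3)]
    by (simp add: cocyc_iff[where \<mu>="vec l N"] cobd_iff[where \<mu>="vec l N"] ab supp_intros Coch_supp[OF cd(1)] \<Phi>D)
  \<comment> \<open>At stage N the image of the new cocycle differs from z by a pair with first
    component 0, whose second component is bounded only after multiplication by x l. Passing to
    stage N + 1 supplies this factor.\<close>
  let ?\<Phi>' = "\<Phi> (vec l N) (vec l (Suc N))" and ?D' = "D J (vec l (Suc N))"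
  have mono': "\<And>j. j \<in> J \<Longrightarrow> vec l N j \<le> vec l (Suc N) j"
    by (simp add: vec_def)
  have \<Phi>C': "?\<Phi>' w \<in> Coch W J (vec l (Suc N)) e' p'" if "stable W" "w \<in> ?C W e' p'" for W w e' p'
    by (rule \<Phi>_Coch[OF that(1) J'(4) mono' that(2)])
  have \<Phi>D': "?D' (?\<Phi>' w) = ?\<Phi>' (?D w)" for w
    using \<Phi>_D[OF J'(1)] mono' by blast
  have comp: "\<Phi> (vec l n) (vec l (Suc N)) w = ?\<Phi>' (?\<Phi> w)" if "supp J w" for w
    using \<Phi>_comp[OF that] mono mono' by simp
  have w2: "cocyc (vec (Suc l) (Suc N)) e p (\<Phi> (vec (Suc l) N) (vec (Suc l) (Suc N)) (join l (?\<Phi> a) c))"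
    using w by (rule cocyc_\<Phi>) (simp add: vec_def)
  have diff: "\<Phi> (vec (Suc l) (Suc N)) (vec l (Suc N)) (\<Phi> (vec (Suc l) N) (vec (Suc l) (Suc N)) (join l (?\<Phi> a) c))
      - \<Phi> (vec l n) (vec l (Suc N)) z = join l 0 (?\<Phi>' (x l ^ N \<odot> c - x l ^ Suc (N - n) \<odot> ?\<Phi> b))"
    using N(1) unfolding ab(3)
    by (simp add: \<Phi>J[where \<mu>="vec l N" and \<mu>'="vec l (Suc N)"] \<Phi>J[where \<mu>="vec l (Suc N)" and \<mu>'="vec l (Suc N)"]
        \<Phi>J[where \<mu>="vec l n" and \<mu>'="vec l (Suc N)"] ab supp_intros Coch_supp[OF cd(1)] comp \<Phi>_linear join_linear Suc_diff_le)
  let ?X = "x l ^ N \<odot> c - x l ^ Suc (N - n) \<odot> ?\<Phi> b"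
  have "?\<Phi>' (- (x l ^ Suc (N - n) \<odot> ?\<Phi> b - (x l ^ N \<odot> c - ?D d))) \<in> Coch V J (vec l (Suc N)) (e + 1 + int N) (p - 1)"
    using \<Phi>C'[OF stable_V] UV_linear(9) cd(4) by blast
  moreover have "?\<Phi>' (- (x l ^ Suc (N - n) \<odot> ?\<Phi> b - (x l ^ N \<odot> c - ?D d)))
      = ?\<Phi>' ?X - (x l ^ Suc N \<odot> 0 - ?D' (- ?\<Phi>' d))"
    by (simp add: \<Phi>D' \<Phi>_linear D_linear del: power_Suc)
  ultimately have X: "?\<Phi>' ?X - (x l ^ Suc N \<odot> 0 - ?D' (- ?\<Phi>' d)) \<in> Coch V J (vec l (Suc N)) (e + int (Suc N)) (p - 1)"
    by (simp add: ac_simps)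
  have "supp J (?\<Phi>' ?X)"
    using ab Coch_supp[OF cd(1)] by (intro supp_intros)
  moreover have "- ?\<Phi>' d \<in> Coch U J (vec l (Suc N)) (e + int (Suc N)) (p - 2)"
    using UV_linear(4)[OF \<Phi>C'[OF stable_U cd(2)]] by (simp add: ac_simps)
  ultimately have "cobd (vec l (Suc N)) e p (join l 0 (?\<Phi>' ?X))"
    using cobd_iff[of 0 "?\<Phi>' ?X" "vec l (Suc N)" "vec l (Suc N)" e p] X UV_linear(1,6) supp_linear(5)
    by (metis D_zero diff_zero vec_simps(1))
  then show ?thesis
    using w2 N(1) diff by (metis le_SucI)
qed

end

section \<open>From local to Koszul cohomology along a diagonal\<close>

context graded_koszul
begin

lemma Coch_agree:
  "(\<And>j. j < m \<Longrightarrow> \<nu> j = \<mu> j) \<Longrightarrow> stable W \<Longrightarrow> Coch W {..<m} \<nu> e p = Coch W {..<m} \<mu> e p"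
  by (rule Coch_cong) (auto simp: stable_ideal is_ideal_zero)

lemma cocyc_agree: "(\<And>j. j < m \<Longrightarrow> \<nu> j = \<mu> j) \<Longrightarrow> cocyc \<nu> e p z = cocyc \<mu> e p z"
  using Coch_agree[OF _ stable_U, of \<nu> \<mu>] Coch_agree[OF _ stable_V, of \<nu> \<mu>] D_cong[of "{..<m}" \<nu> \<mu>]
  by (simp add: cocyc_def)

lemma cobd_agree: "(\<And>j. j < m \<Longrightarrow> \<nu> j = \<mu> j) \<Longrightarrow> cobd \<nu> e p z = cobd \<mu> e p z"
  using Coch_agree[OF _ stable_U, of \<nu> \<mu>] Coch_agree[OF _ stable_V, of \<nu> \<mu>] D_cong[of "{..<m}" \<nu> \<mu>]
  by (simp add: cobd_def)

lemma \<Phi>_agree: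
  "cocyc \<kappa> e p z \<Longrightarrow> (\<And>j. j < m \<Longrightarrow> \<nu> j = \<nu>' j \<and> \<mu> j = \<mu>' j) \<Longrightarrow> \<Phi> \<nu> \<mu> z = \<Phi> \<nu>' \<mu>' z"
  by (rule \<Phi>_cong[of "{..<m}"]) (auto simp: cocyc_def intro: Coch_supp)

lemma \<Phi>_trans:
  "cocyc \<kappa> e p z \<Longrightarrow> (\<And>j. j < m \<Longrightarrow> \<nu> j \<le> \<mu> j \<and> \<mu> j \<le> \<mu>' j) \<Longrightarrow> \<Phi> \<mu> \<mu>' (\<Phi> \<nu> \<mu> z) = \<Phi> \<nu> \<mu>' z"
  by (rule \<Phi>_comp[of "{..<m}"]) (auto simp: cocyc_def intro: Coch_supp)

lemma cobd_zero: "cobd \<nu> e p 0"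
  unfolding cobd_def by (rule bexI[of _ 0]) (simp_all add: UV_linear)

lemma vanish_neg: "p < 0 \<Longrightarrow> vanish l p e"
proof -
  assume "p < 0"
  then have "z = 0" if "cocyc (vec l n) e p z" for n z
    using that by (auto simp: cocyc_def Coch_def fun_eq_iff)
  then show ?thesis
    by (force simp: vanish_def intro: cobd_zero)
qed

text \<open>\<open>vanish_Suc\<close> reads the positions (p, e) and (p - 1, e + 1), which have the
  same sum, so induction on l stays on one diagonal; in negative cohomological degrees all cochains
  are zero.\<close>

lemma vanish_diagonal:
  assumes "\<And>j. 0 \<le> j \<Longrightarrow> j \<le> i \<Longrightarrow> vanish 0 j (s - j)" and "l \<le> m" and "j \<le> i"
  shows "vanish l j (s - j)"
  using assms(2,3)
proof (induction l arbitrary: j)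
  case 0
  then show ?case using assms(1) vanish_neg by (cases "j < 0") auto
next
  case (Suc l)
  have "vanish l (j - 1) (s - j + 1)" using Suc.IH[of "j - 1"] Suc.prems by (simp add: algebra_simps)
  then show ?case using Suc by (intro vanish_Suc) auto
qed

text \<open>For l = m all relevant exponents are 1 and the direct system is constant, so dying in
  the colimit means being a coboundary already.\<close>

lemma Koszul_vanish:
  assumes "\<And>j. 0 \<le> j \<Longrightarrow> j \<le> i \<Longrightarrow> vanish 0 j (s - j)" and e: "e = s - i"
    and z: "cocyc (\<lambda>_. 1) e i z"
  shows "cobd (\<lambda>_. 1) e i z"
proof -
  have v1: "vec m n j = 1" if "j < m" for n j using that by (simp add: vec_def)
  have "vanish m i e"
    unfolding e by (rule vanish_diagonal) (use assms(1) in auto)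
  moreover have "cocyc (vec m 1) e i z"
    using z cocyc_agree[of "vec m 1" "\<lambda>_. 1"] v1 by simp
  ultimately obtain N where "N \<ge> 1" "cobd (vec m N) e i (\<Phi> (vec m 1) (vec m N) z)"
    unfolding vanish_def by blast
  moreover have "\<Phi> (vec m 1) (vec m N) z = \<Phi> (\<lambda>_. 1) (\<lambda>_. 1) z"
    by (rule \<Phi>_agree[OF z]) (simp add: v1)
  ultimately show ?thesis
    using cobd_agree[of "vec m N" "\<lambda>_. 1"] v1 by simp
qed

lemma cobd_diff_trans:
  assumes "cobd \<nu> e p (a - b)" "cobd \<nu> e p (b - c)" shows "cobd \<nu> e p (a - c)"
  using cobd_add[OF assms] by simp

text \<open>The exponents are lowered to 1 one generator at a time; each preimage is lifted further
  by \<open>surj_Suc\<close>, and the differences are compared in the system with equal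
  exponents.\<close>

lemma Koszul_surj:
  assumes van: "\<And>j. 0 \<le> j \<Longrightarrow> j \<le> i \<Longrightarrow> vanish 0 j (s - j)" and e: "e + 1 = s - i"
    and n: "n \<ge> 1" and z: "cocyc (\<lambda>_. n) e i z"
  shows "\<exists>N\<ge>n. \<exists>w. cocyc (\<lambda>_. 1) e i w \<and>
    cobd (\<lambda>_. N) e i (\<Phi> (\<lambda>_. 1) (\<lambda>_. N) w - \<Phi> (\<lambda>_. n) (\<lambda>_. N) z)"
proof -
  have "\<exists>N\<ge>n. \<exists>w. cocyc (vec l N) e i w \<and>
      cobd (\<lambda>_. N) e i (\<Phi> (vec l N) (\<lambda>_. N) w - \<Phi> (\<lambda>_. n) (\<lambda>_. N) z)" if "l \<le> m" for l
    using that
  proof (induction l)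
    case 0
    have "cocyc (vec 0 n) e i z \<and> cobd (\<lambda>_. n) e i (\<Phi> (vec 0 n) (\<lambda>_. n) z - \<Phi> (\<lambda>_. n) (\<lambda>_. n) z)"
      using z by (simp add: cobd_zero)
    then show ?case by blast
  next
    case (Suc l)
    then obtain N w where N: "N \<ge> n" "cocyc (vec l N) e i w"
      "cobd (\<lambda>_. N) e i (\<Phi> (vec l N) (\<lambda>_. N) w - \<Phi> (\<lambda>_. n) (\<lambda>_. N) z)"
      using Suc_leD by blast
    \<comment> \<open>The position (i, e + 1) is on the diagonal s, one above that of z.\<close>
    have "vanish l i (e + 1)"
      unfolding e using vanish_diagonal[OF van] Suc.prems by simp
    from surj_Suc[OF _ this _ N(2)] Suc.prems n N(1)
    obtain N' w' where N': "N' \<ge> N" "cocyc (vec (Suc l) N') e i w'"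
      "cobd (vec l N') e i (\<Phi> (vec (Suc l) N') (vec l N') w' - \<Phi> (vec l N) (vec l N') w)" by auto
    have le: "vec k M j \<le> N'" if "M \<le> N'" for k M j
      using that n N(1) N'(1) by (simp add: vec_def)
    have "cobd (\<lambda>_. N') e i (\<Phi> (vec l N') (\<lambda>_. N') (\<Phi> (vec (Suc l) N') (vec l N') w' - \<Phi> (vec l N) (vec l N') w))"
      by (rule cobd_\<Phi>[OF N'(3)]) (simp add: le)
    moreover have "\<Phi> (vec l N') (\<lambda>_. N') (\<Phi> (vec (Suc l) N') (vec l N') w') = \<Phi> (vec (Suc l) N') (\<lambda>_. N') w'"
      by (rule \<Phi>_trans[OF N'(2)]) (use le vec_mono n N(1) N'(1) in simp)
    moreover have "\<Phi> (vec l N') (\<lambda>_. N') (\<Phi> (vec l N) (vec l N') w) = \<Phi> (\<lambda>_. N) (\<lambda>_. N') (\<Phi> (vec l N) (\<lambda>_. N) w)"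
    proof -
      have "\<Phi> (vec l N') (\<lambda>_. N') (\<Phi> (vec l N) (vec l N') w) = \<Phi> (vec l N) (\<lambda>_. N') w"
        by (rule \<Phi>_trans[OF N(2)]) (use le vec_mono n N(1) N'(1) in simp)
      also have "\<dots> = \<Phi> (\<lambda>_. N) (\<lambda>_. N') (\<Phi> (vec l N) (\<lambda>_. N) w)"
        by (rule \<Phi>_trans[OF N(2), symmetric]) (use n N(1) N'(1) in \<open>simp add: vec_def\<close>)
      finally show ?thesis .
    qed
    ultimately have "cobd (\<lambda>_. N') e i (\<Phi> (vec (Suc l) N') (\<lambda>_. N') w' - \<Phi> (\<lambda>_. N) (\<lambda>_. N') (\<Phi> (vec l N) (\<lambda>_. N) w))"
      by (simp add: \<Phi>_linear)
    moreover have "cobd (\<lambda>_. N') e i (\<Phi> (\<lambda>_. N) (\<lambda>_. N') (\<Phi> (vec l N) (\<lambda>_. N) w) - \<Phi> (\<lambda>_. n) (\<lambda>_. N') z)"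
      using cobd_\<Phi>[OF N(3), of "\<lambda>_. N'"] N'(1) \<Phi>_trans[OF z, of "\<lambda>_. n" "\<lambda>_. N" "\<lambda>_. N'"] N(1)
      by (simp add: \<Phi>_linear)
    ultimately have "cobd (\<lambda>_. N') e i (\<Phi> (vec (Suc l) N') (\<lambda>_. N') w' - \<Phi> (\<lambda>_. n) (\<lambda>_. N') z)"
      by (rule cobd_diff_trans)
    then show ?case using N' N(1) le_trans by blast
  qed
  from this[of m] obtain N w where N: "N \<ge> n" "cocyc (vec m N) e i w"
    "cobd (\<lambda>_. N) e i (\<Phi> (vec m N) (\<lambda>_. N) w - \<Phi> (\<lambda>_. n) (\<lambda>_. N) z)" by auto
  have v1: "vec m n j = 1" if "j < m" for n j using that by (simp add: vec_def)
  have "\<Phi> (vec m N) (\<lambda>_. N) w = \<Phi> (\<lambda>_. 1) (\<lambda>_. N) w"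
    by (rule \<Phi>_agree[OF N(2)]) (simp add: v1)
  moreover have "cocyc (\<lambda>_. 1) e i w"
    using N(2) cocyc_agree[of "vec m N" "\<lambda>_. 1"] v1 by simp
  ultimately show ?thesis using N by metis
qed

end

section \<open>The Artin--Rees lemma\<close>

lemma scal_add_left: "(a + b) \<odot> c = a \<odot> c + b \<odot> c"
  by (auto simp: fun_eq_iff distrib_right)

lemma is_ideal_ideal_gen [simp]: "is_ideal (ideal_gen S)"
  unfolding ideal_gen_def is_ideal_def by auto

lemma ideal_gen_incl: "S \<subseteq> ideal_gen S"
  by (auto simp: ideal_gen_def)

lemma ideal_gen_least: "is_ideal I \<Longrightarrow> S \<subseteq> I \<Longrightarrow> ideal_gen S \<subseteq> I"
  by (auto simp: ideal_gen_def)

lemma ideal_gen_image_finite: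
  assumes "finite X" "a \<in> ideal_gen (f ` X)"
  shows "\<exists>k. a = (\<Sum>\<alpha>\<in>X. k \<alpha> * f \<alpha>)"
proof -
  let ?I = "{a. \<exists>k. a = (\<Sum>\<alpha>\<in>X. k \<alpha> * f \<alpha>)}"
  have "0 \<in> ?I"
    by (rule CollectI, rule exI[of _ "\<lambda>_. 0"]) simp
  moreover have "\<exists>l. (\<Sum>\<alpha>\<in>X. k \<alpha> * f \<alpha>) + (\<Sum>\<alpha>\<in>X. k' \<alpha> * f \<alpha>) = (\<Sum>\<alpha>\<in>X. l \<alpha> * f \<alpha>)" for k k'
    by (rule exI[of _ "\<lambda>\<alpha>. k \<alpha> + k' \<alpha>"]) (simp add: sum.distrib distrib_right)
  moreover have "\<exists>l. r * (\<Sum>\<alpha>\<in>X. k \<alpha> * f \<alpha>) = (\<Sum>\<alpha>\<in>X. l \<alpha> * f \<alpha>)" for r k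
    by (rule exI[of _ "\<lambda>\<alpha>. r * k \<alpha>"]) (simp add: sum_distrib_left mult.assoc)
  ultimately have "is_ideal ?I"
    unfolding is_ideal_def by blast
  moreover have "f \<beta> \<in> ?I" if "\<beta> \<in> X" for \<beta>
    using that assms(1)
    by (intro CollectI exI[of _ "\<lambda>\<alpha>. if \<alpha> = \<beta> then 1 else 0"]) (simp add: if_distrib[of "\<lambda>k. k * _"] sum.delta cong: if_cong)
  ultimately show ?thesis
    using assms(2) ideal_gen_least[of ?I "f ` X"] by blast
qed

lemma is_ideal_Union_chain:
  assumes "\<And>n::nat. is_ideal (I n)" "\<And>n. I n \<subseteq> I (Suc n)"
  shows "is_ideal (\<Union>n. I n)"
proof -
  have mono: "I a \<subseteq> I b" if "a \<le> b" for a b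
    using lift_Suc_mono_le[of I, OF assms(2) that] .
  have "a + b \<in> (\<Union>n. I n)" if "a \<in> I n" "b \<in> I k" for a b n k
  proof (rule UN_I[of "max n k"])
    show "a + b \<in> I (max n k)"
      using that mono[of n "max n k"] mono[of k "max n k"] by (intro is_ideal_add[OF assms(1)]) auto
  qed simp
  moreover have "0 \<in> (\<Union>n. I n)"
    using is_ideal_zero[OF assms(1)] by blast
  moreover have "r * a \<in> (\<Union>n. I n)" if "a \<in> I n" for a r n
    using is_ideal_mult[OF assms(1) that] by blast
  ultimately show ?thesis
    unfolding is_ideal_def by auto
qed

lemma noetherian_chain_stable:
  assumes "noetherian_ring TYPE('a::comm_ring_1)"
    and "\<And>n::nat. is_ideal (I n :: 'a set)" "\<And>n. I n \<subseteq> I (Suc n)"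
  shows "\<exists>N. \<forall>n. I n \<subseteq> I N"
proof -
  have mono: "I a \<subseteq> I b" if "a \<le> b" for a b
    using lift_Suc_mono_le[of I, OF assms(3) that] .
  obtain F where F: "finite F" "(\<Union>n. I n) = ideal_gen F"
    using assms(1)[unfolded noetherian_ring_def, rule_format, OF is_ideal_Union_chain[of I, OF assms(2,3)]]
    by auto
  have "\<forall>a\<in>F. \<exists>n. a \<in> I n" using F(2) ideal_gen_incl by blast
  then obtain f where f: "\<And>a. a \<in> F \<Longrightarrow> a \<in> I (f a)" by metis
  have "a \<in> I (Max (f ` F))" if "a \<in> F" for a
    using f[OF that] mono[of "f a" "Max (f ` F)"] F(1) that by auto
  then obtain N where "F \<subseteq> I N" by blast
  then show ?thesis
    using F(2) ideal_gen_least[OF assms(2)[of N]] by blast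
qed

lemma pointwise_mono_from_inc:
  assumes "list_all2 (\<le>) \<alpha> \<beta>"
    and "\<And>\<gamma> j. length \<gamma> = length \<alpha> \<Longrightarrow> j < length \<alpha> \<Longrightarrow> F \<gamma> \<subseteq> F (\<gamma>[j := Suc (\<gamma> ! j)])"
  shows "F \<alpha> \<subseteq> F \<beta>"
  using assms
proof (induction arbitrary: F rule: list_all2_induct)
  case (Cons a \<alpha> b \<beta>)
  have "F (a # \<alpha>) \<subseteq> F (b # \<alpha>)"
    using Cons.hyps(1)
  proof (induction b rule: dec_induct)
    case (step n)
    then show ?case using Cons.prems[of "n # \<alpha>" 0] by auto
  qed simp
  also have "F (b # \<alpha>) \<subseteq> F (b # \<beta>)"
    using Cons.IH[of "\<lambda>\<gamma>. F (b # \<gamma>)"] Cons.prems[of "b # _" "Suc _"] by simp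
  finally show ?case .
qed simp

text \<open>Applied to ideals of leading coefficients, this replaces Hilbert's basis theorem.\<close>
lemma noetherian_monotone_stable:
  assumes noeth: "noetherian_ring TYPE('a::comm_ring_1)"
    and "\<And>\<alpha>. length \<alpha> = m \<Longrightarrow> is_ideal (F \<alpha> :: 'a set)"
    and "\<And>\<alpha> \<beta>. length \<alpha> = m \<Longrightarrow> list_all2 (\<le>) \<alpha> \<beta> \<Longrightarrow> F \<alpha> \<subseteq> F \<beta>"
  shows "\<exists>c::nat. \<forall>\<alpha>. length \<alpha> = m \<longrightarrow> F \<alpha> \<subseteq> F (map (min c) \<alpha>)"
  using assms(2,3)
proof (induction m arbitrary: F)
  case 0
  then show ?case by simp
next
  case (Suc m)
  have refl: "list_all2 (\<le>) \<alpha> \<alpha>" for \<alpha> :: "nat list" by (simp add: list_all2_refl)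
  have minc: "list_all2 (\<le>) (map (min c) \<alpha>) (map (min c') \<alpha>)" if "c \<le> c'" for c c' and \<alpha> :: "nat list"
    using that by (auto simp: list_all2_map1 list_all2_map2 intro!: list_all2_refl)
  have head: "F (n # \<alpha>) \<subseteq> F (n' # \<alpha>)" if "n \<le> n'" "length \<alpha> = m" for n n' \<alpha>
    using that by (intro Suc.prems(2)) (auto simp: refl)
  have tail: "F (n # \<alpha>) \<subseteq> F (n # \<beta>)" if "length \<alpha> = m" "list_all2 (\<le>) \<alpha> \<beta>" for n \<alpha> \<beta>
    using that by (intro Suc.prems(2)) auto
  \<comment> \<open>The union over the first entry depends on m entries only, so the induction
    hypothesis applies. It leaves finitely many truncated tails, along each of which the first entry
    stabilises by some \<open>c2\<close>; the finitely many slices with first entry at most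
    \<open>c2\<close> are bounded separately by \<open>g\<close>.\<close>
  define J where "J \<alpha> = (\<Union>n. F (n # \<alpha>))" for \<alpha>
  have "\<exists>c. \<forall>\<alpha>. length \<alpha> = m \<longrightarrow> J \<alpha> \<subseteq> J (map (min c) \<alpha>)"
  proof (rule Suc.IH)
    show "is_ideal (J \<alpha>)" if "length \<alpha> = m" for \<alpha>
      unfolding J_def using that Suc.prems(1) head by (intro is_ideal_Union_chain) auto
    show "J \<alpha> \<subseteq> J \<beta>" if "length \<alpha> = m" "list_all2 (\<le>) \<alpha> \<beta>" for \<alpha> \<beta>
      using tail[OF that] unfolding J_def by blast
  qed
  then obtain c1 where c1: "\<And>\<alpha>. length \<alpha> = m \<Longrightarrow> J \<alpha> \<subseteq> J (map (min c1) \<alpha>)" by blast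
  define B where "B = {\<beta>. set \<beta> \<subseteq> {..c1} \<and> length \<beta> = m}"
  have "finite B" unfolding B_def by (rule finite_lists_length_eq) simp
  have "\<forall>\<beta>\<in>B. \<exists>N. \<forall>n. F (n # \<beta>) \<subseteq> F (N # \<beta>)"
    using Suc.prems(1) head by (intro ballI noetherian_chain_stable[OF noeth]) (auto simp: B_def)
  then obtain f where f: "\<And>\<beta> n. \<beta> \<in> B \<Longrightarrow> F (n # \<beta>) \<subseteq> F (f \<beta> # \<beta>)" by metis
  define c2 where "c2 = Max (insert 0 (f ` B))"
  have c2: "f \<beta> \<le> c2" if "\<beta> \<in> B" for \<beta>
    unfolding c2_def using that \<open>finite B\<close> by (intro Max_ge) auto
  have "\<exists>c. \<forall>\<alpha>. length \<alpha> = m \<longrightarrow> F (n # \<alpha>) \<subseteq> F (n # map (min c) \<alpha>)" for n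
    by (rule Suc.IH) (use Suc.prems(1) tail in auto)
  then obtain g where g: "\<And>n \<alpha>. length \<alpha> = m \<Longrightarrow> F (n # \<alpha>) \<subseteq> F (n # map (min (g n)) \<alpha>)" by metis
  define c where "c = Max (insert c1 (insert c2 (g ` {..c2})))"
  have c: "c1 \<le> c" "c2 \<le> c" "\<And>n. n \<le> c2 \<Longrightarrow> g n \<le> c"
    unfolding c_def by (rule Max_ge; simp)+
  have "F (n # \<alpha>) \<subseteq> F (min c n # map (min c) \<alpha>)" if \<alpha>: "length \<alpha> = m" for n \<alpha>
  proof (cases "n \<le> c2")
    case True
    have "F (n # \<alpha>) \<subseteq> F (n # map (min (g n)) \<alpha>)" using g[OF \<alpha>] .
    also have "\<dots> \<subseteq> F (n # map (min c) \<alpha>)" using tail minc[OF c(3)[OF True]] \<alpha> by simp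
    finally show ?thesis using True c(2) by (simp add: min_absorb2)
  next
    case False
    let ?\<beta> = "map (min c1) \<alpha>"
    have \<beta>: "?\<beta> \<in> B" using \<alpha> by (auto simp: B_def)
    have "F (n # \<alpha>) \<subseteq> J ?\<beta>" using c1[OF \<alpha>] by (auto simp: J_def)
    also have "\<dots> \<subseteq> F (f ?\<beta> # ?\<beta>)" using f[OF \<beta>] by (auto simp: J_def)
    also have "\<dots> \<subseteq> F (min c n # ?\<beta>)" using head c2[OF \<beta>] c(2) False \<alpha> by simp
    also have "\<dots> \<subseteq> F (min c n # map (min c) \<alpha>)" using tail minc[OF c(1)] \<alpha> by simp
    finally show ?thesis .
  qed
  then have "\<forall>\<alpha>. length \<alpha> = Suc m \<longrightarrow> F \<alpha> \<subseteq> F (map (min c) \<alpha>)"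
    by (metis length_Suc_conv list.simps(9))
  then show ?case by blast
qed

text \<open>This makes the lexicographic order a monomial order: multiplying by a generator
  preserves the comparison of monomials.\<close>

lemma list_update_Suc_less:
  fixes b b' :: "nat list"
  assumes "length b = length b'" "b < b'"
  shows "b[i := Suc (b ! i)] < b'[i := Suc (b' ! i)]"
  using assms
proof (induction b b' arbitrary: i rule: list_induct2)
  case (Cons a b a' b')
  then show ?case by (cases i) auto
qed simp

lemma submodule_sum:
  assumes "0 \<in> Z" "\<And>z w. z \<in> Z \<Longrightarrow> w \<in> Z \<Longrightarrow> z + w \<in> Z" "\<And>i. i \<in> A \<Longrightarrow> f i \<in> Z"
  shows "sum f A \<in> (Z :: 'b::comm_monoid_add set)"
  using assms(3) by (induction A rule: infinite_finite_induct) (auto simp: assms(1,2))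

section \<open>Monomials in the generators\<close>

locale ideal_generators =
  fixes xs :: "'a::comm_ring_1 list" and q :: "'a set"
  assumes noeth: "noetherian_ring TYPE('a)" and gen: "ideal_gen (set xs) = q"
begin

definition mon :: "nat list \<Rightarrow> 'a" where
  "mon \<alpha> = (\<Prod>j<length xs. xs ! j ^ (\<alpha> ! j))"

definition Mon :: "nat \<Rightarrow> nat list set" where
  "Mon n = {\<alpha>. length \<alpha> = length xs \<and> sum_list \<alpha> = n}"

lemma finite_Mon: "finite (Mon n)"
proof (rule finite_subset)
  show "Mon n \<subseteq> {\<alpha>. set \<alpha> \<subseteq> {..n} \<and> length \<alpha> = length xs}"
    unfolding Mon_def using member_le_sum_list by fastforce
  show "finite {\<alpha>. set \<alpha> \<subseteq> {..n} \<and> length \<alpha> = length xs}"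
    by (rule finite_lists_length_eq) simp
qed

lemma mon_inc: "length \<alpha> = length xs \<Longrightarrow> j < length xs \<Longrightarrow> mon (\<alpha>[j := Suc (\<alpha> ! j)]) = xs ! j * mon \<alpha>"
proof -
  assume a: "length \<alpha> = length xs" "j < length xs"
  have "(\<Prod>i\<in>{..<length xs} - {j}. xs ! i ^ (\<alpha>[j := Suc (\<alpha> ! j)] ! i)) = (\<Prod>i\<in>{..<length xs} - {j}. xs ! i ^ (\<alpha> ! i))"
    by (rule prod.cong) auto
  then show ?thesis
    unfolding mon_def
    using a prod.remove[of "{..<length xs}" j "\<lambda>i. xs ! i ^ (\<alpha> ! i)"]
      prod.remove[of "{..<length xs}" j "\<lambda>i. xs ! i ^ (\<alpha>[j := Suc (\<alpha> ! j)] ! i)"]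
    by (simp add: mult.assoc)
qed

lemma Mon_inc: "\<alpha> \<in> Mon n \<Longrightarrow> j < length xs \<Longrightarrow> \<alpha>[j := Suc (\<alpha> ! j)] \<in> Mon (Suc n)"
  by (simp add: Mon_def sum_list_update)

lemma Mon_dec:
  assumes "\<alpha> \<in> Mon (Suc n)" "j < length xs" "\<alpha> ! j > 0"
  shows "\<alpha>[j := \<alpha> ! j - 1] \<in> Mon n" "\<alpha> = (\<alpha>[j := \<alpha> ! j - 1])[j := Suc (\<alpha>[j := \<alpha> ! j - 1] ! j)]"
  using assms by (auto simp: Mon_def sum_list_update)

lemma gen_mem: "j < length xs \<Longrightarrow> xs ! j \<in> q"
  using gen ideal_gen_incl[of "set xs"] by auto

lemma is_ideal_pow: "is_ideal (ideal_pow q n)"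
  by (cases n) (simp_all, simp add: is_ideal_def)

lemma ideal_pow_mult: "a \<in> ideal_pow q n \<Longrightarrow> j < length xs \<Longrightarrow> xs ! j * a \<in> ideal_pow q (Suc n)"
proof -
  assume "a \<in> ideal_pow q n" "j < length xs"
  then have "a * xs ! j \<in> {a * b |a b. a \<in> ideal_pow q n \<and> b \<in> q}" using gen_mem by blast
  then have "a * xs ! j \<in> ideal_pow q (Suc n)"
    unfolding ideal_pow.simps by (rule subsetD[OF ideal_gen_incl])
  then show ?thesis by (simp add: mult.commute)
qed

lemma mon_in_ideal_pow: "\<alpha> \<in> Mon n \<Longrightarrow> mon \<alpha> \<in> ideal_pow q n"
proof (induction n arbitrary: \<alpha>)
  case (Suc n)
  have "\<exists>j<length xs. \<alpha> ! j > 0"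
  proof (rule ccontr)
    assume "\<not> ?thesis"
    then have "\<forall>a\<in>set \<alpha>. a = 0" using Suc.prems by (auto simp: Mon_def in_set_conv_nth)
    then have "sum_list \<alpha> = 0" by simp
    moreover have "sum_list \<alpha> = Suc n" using Suc.prems by (simp add: Mon_def)
    ultimately show False by linarith
  qed
  then obtain j where j: "j < length xs" "\<alpha> ! j > 0" by blast
  have "length (\<alpha>[j := \<alpha> ! j - 1]) = length xs" using Suc.prems by (simp add: Mon_def)
  then have "mon \<alpha> = xs ! j * mon (\<alpha>[j := \<alpha> ! j - 1])"
    using mon_inc[of "\<alpha>[j := \<alpha> ! j - 1]" j] j(1) by (subst Mon_dec(2)[OF Suc.prems j]) simp
  then show ?case
    using ideal_pow_mult[OF Suc.IH[OF Mon_dec(1)[OF Suc.prems j]] j(1)] by simp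
qed simp

lemma ideal_pow_subset_monomials: "ideal_pow q n \<subseteq> ideal_gen (mon ` Mon n)"
proof (induction n)
  case 0
  have "replicate (length xs) 0 \<in> Mon 0" by (simp add: Mon_def)
  moreover have "mon (replicate (length xs) 0) = 1" by (simp add: mon_def)
  ultimately have "1 \<in> ideal_gen (mon ` Mon 0)" using ideal_gen_incl by (metis image_eqI subsetD)
  then show ?case using is_ideal_mult[OF is_ideal_ideal_gen, of 1] by fastforce
next
  case (Suc n)
  let ?S = "ideal_gen (mon ` Mon (Suc n))"
  have 1: "a * xs ! j \<in> ?S" if "a \<in> ideal_gen (mon ` Mon n)" "j < length xs" for a j
  proof -
    have "is_ideal {a. a * xs ! j \<in> ?S}"
      unfolding is_ideal_def
      by (auto simp: distrib_right mult.assoc is_ideal_zero is_ideal_add is_ideal_mult)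
    moreover have "mon \<alpha> * xs ! j \<in> ?S" if "\<alpha> \<in> Mon n" for \<alpha>
    proof -
      have "mon (\<alpha>[j := Suc (\<alpha> ! j)]) \<in> ?S"
        using Mon_inc[OF \<open>\<alpha> \<in> Mon n\<close> \<open>j < length xs\<close>] ideal_gen_incl by blast
      moreover have "length \<alpha> = length xs" using \<open>\<alpha> \<in> Mon n\<close> by (simp add: Mon_def)
      ultimately show ?thesis using mon_inc \<open>j < length xs\<close> by (simp add: mult.commute)
    qed
    ultimately show ?thesis
      using that(1) ideal_gen_least[of "{a. a * xs ! j \<in> ?S}" "mon ` Mon n"] by blast
  qed
  have 2: "a * b \<in> ?S" if "a \<in> ideal_gen (mon ` Mon n)" "b \<in> q" for a b
  proof -
    have "is_ideal {b. a * b \<in> ?S}"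
      unfolding is_ideal_def
      by (auto simp: distrib_left mult.left_commute[of a] is_ideal_zero is_ideal_add is_ideal_mult)
    moreover have "set xs \<subseteq> {b. a * b \<in> ?S}"
      using 1[OF that(1)] by (auto simp: in_set_conv_nth)
    ultimately show ?thesis
      using that(2) ideal_gen_least[of "{b. a * b \<in> ?S}"] gen by blast
  qed
  show ?case
    unfolding ideal_pow.simps
    by (rule ideal_gen_least) (use Suc 2 in auto)
qed

text \<open>For a submodule \<^term>\<open>Z\<close> of a finite free module, the ideals of leading coefficients
  of its elements are indexed by the monomial multiples \<open>x\<^sup>\<alpha> e\<^sub>s\<close> of the basis vectors, encoded as
  lists \<open>s # \<alpha>\<close> and ordered lexicographically.\<close>
theorem Artin_Rees:
  fixes Z :: "('s \<Rightarrow> 'a) set"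
  assumes Z0: "0 \<in> Z" and Zadd: "\<And>z w. z \<in> Z \<Longrightarrow> w \<in> Z \<Longrightarrow> z + w \<in> Z"
    and Zscal: "\<And>r z. z \<in> Z \<Longrightarrow> r \<odot> z \<in> Z"
    and S: "finite S" and ZS: "\<And>z s. z \<in> Z \<Longrightarrow> s \<notin> S \<Longrightarrow> z s = 0"
  shows "\<exists>c. \<forall>n\<ge>c. \<forall>z\<in>Z. (\<forall>s. z s \<in> ideal_pow q (Suc n)) \<longrightarrow>
    (\<exists>u. (\<forall>j<length xs. u j \<in> Z \<and> (\<forall>s. u j s \<in> ideal_pow q n)) \<and> z = (\<Sum>j<length xs. xs ! j \<odot> u j))"
proof -
  let ?m = "length xs"
  obtain h where h: "bij_betw h {..<card S} S"
    using ex_bij_betw_nat_finite[OF S] atLeast0LessThan by metis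
  define r where "r = card S"
  define tv where "tv b = (\<lambda>s. if s = h (hd b) then mon (tl b) else 0)" for b
  define Idx where "Idx n = (\<lambda>(i, \<alpha>). i # \<alpha>) ` ({..<r} \<times> Mon n)" for n
  define lin where "lin X = {z :: 's \<Rightarrow> 'a. \<exists>k. z = (\<Sum>b\<in>X. k b \<odot> tv b)}" for X :: "nat list set"
  define inc where "inc j b = b[Suc j := Suc (b ! Suc j)]" for j and b :: "nat list"
  define Low where "Low n b = {c \<in> Idx n. c < b}" for n b
  \<comment> \<open>The vectors \<open>tv b\<close> may be linearly dependent over A, so a leading
    coefficient belongs to a presentation, not to an element. \<open>I b\<close> collects the
    coefficients at b over all presentations of elements of Z by terms of the same degree and no
    larger than b, as if Z were lifted to a free module over the polynomial ring.\<close>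
  define I where "I b = {a. \<exists>z\<in>Z. z - a \<odot> tv b \<in> lin (Low (sum_list (tl b)) b)}" for b
  have finIdx: "finite (Idx n)" for n
    unfolding Idx_def using finite_Mon by auto
  have linI: "(\<Sum>b\<in>X. k b \<odot> tv b) \<in> lin X" for k X
    unfolding lin_def by blast
  have lin_apply: "(\<Sum>b\<in>X. k b \<odot> tv b) s = (\<Sum>b\<in>X. k b * tv b s)" for k X s
    by (induction X rule: infinite_finite_induct) auto
  have lin0: "0 \<in> lin X" for X
    unfolding lin_def by (rule CollectI, rule exI[of _ "\<lambda>_. 0"]) simp
  have lin_add: "z + w \<in> lin X" if z: "z \<in> lin X" and w: "w \<in> lin X" for z w X
  proof -
    obtain k k' where "z = (\<Sum>b\<in>X. k b \<odot> tv b)" "w = (\<Sum>b\<in>X. k' b \<odot> tv b)"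
      using z w by (auto simp: lin_def)
    then have "z + w = (\<Sum>b\<in>X. (k b + k' b) \<odot> tv b)"
      by (simp only: sum.distrib[symmetric] scal_add_left)
    then show ?thesis using linI[of "\<lambda>b. k b + k' b" X] by simp
  qed
  have scal_sum: "r \<odot> sum f X = (\<Sum>b\<in>X. r \<odot> f b)" for r and f :: "nat list \<Rightarrow> 's \<Rightarrow> 'a" and X
    by (induction X rule: infinite_finite_induct) (simp_all only: simp_thms sum.infinite sum.empty sum.insert scal_simps scal_distrib)
  have lin_scal: "r \<odot> z \<in> lin X" if z: "z \<in> lin X" for r z X
  proof -
    obtain k where "z = (\<Sum>b\<in>X. k b \<odot> tv b)"
      using z by (auto simp: lin_def)
    then have "r \<odot> z = (\<Sum>b\<in>X. (r * k b) \<odot> tv b)"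
      by (simp add: scal_sum)
    then show ?thesis using linI[of "\<lambda>b. r * k b" X] by simp
  qed
  have lin_tv: "tv b \<in> lin X" if "finite X" "b \<in> X" for b X
  proof -
    have "(\<Sum>c\<in>X. (if c = b then 1 else 0) \<odot> tv c) = (\<Sum>c\<in>X. if c = b then tv c else 0)"
      by (rule sum.cong) auto
    also have "\<dots> = tv b" using that by simp
    finally show ?thesis using linI[of "\<lambda>c. if c = b then 1 else 0" X] by simp
  qed
  have lin_sum: "z \<in> lin Y" if z: "z \<in> lin X" and "\<And>b. b \<in> X \<Longrightarrow> tv b \<in> lin Y" for z X Y
    using z unfolding lin_def[of X] by (auto intro!: submodule_sum[of "lin Y"] lin0 lin_add lin_scal that(2))
  have lin_mono: "z \<in> lin Y" if "z \<in> lin X" "X \<subseteq> Y" "finite Y" for z X Y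
    using that by (intro lin_sum[of z X Y] lin_tv) auto
  have lin_diff: "z - w \<in> lin X" if "z \<in> lin X" "w \<in> lin X" for z w X
  proof -
    have "z - w = z + (- 1) \<odot> w" by (auto simp: fun_eq_iff)
    then show ?thesis using that lin_add lin_scal by metis
  qed
  have Idx_iff: "b \<in> Idx n \<longleftrightarrow> (\<exists>i \<alpha>. b = i # \<alpha> \<and> i < r \<and> \<alpha> \<in> Mon n)" for b n
    unfolding Idx_def by auto
  have Idx_inc: "inc j b \<in> Idx (Suc n)" if "b \<in> Idx n" "j < ?m" for b n j
    using that Mon_inc unfolding Idx_iff inc_def by auto
  have len_Idx: "length b = Suc ?m" if "b \<in> Idx n" for b n
    using that unfolding Idx_iff Mon_def by auto
  have tv_inc: "xs ! j \<odot> tv b = tv (inc j b)" if bn: "b \<in> Idx n" and j: "j < ?m" for b n j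
  proof -
    obtain i \<alpha> where b: "b = i # \<alpha>" "length \<alpha> = ?m" using bn by (auto simp: Idx_iff Mon_def)
    then show ?thesis
      using mon_inc[of \<alpha> j] j by (auto simp: tv_def inc_def fun_eq_iff)
  qed
  have lin_inc: "xs ! j \<odot> z \<in> lin (Low (Suc n) (inc j b))"
    if z: "z \<in> lin (Low n b)" and b: "b \<in> Idx n" "j < ?m" for z n b j
  proof -
    obtain k where k: "z = (\<Sum>c\<in>Low n b. k c \<odot> tv c)" using z by (auto simp: lin_def)
    have "xs ! j \<odot> k c \<odot> tv c \<in> lin (Low (Suc n) (inc j b))" if c: "c \<in> Low n b" for c
    proof -
      have c': "c \<in> Idx n" "c < b" using c by (auto simp: Low_def)
      then have "inc j c < inc j b"
        unfolding inc_def using len_Idx b by (intro list_update_Suc_less) auto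
      then have "tv (inc j c) \<in> lin (Low (Suc n) (inc j b))"
        using Idx_inc[OF c'(1) b(2)] finIdx by (intro lin_tv) (auto simp: Low_def)
      then have "k c \<odot> xs ! j \<odot> tv c \<in> lin (Low (Suc n) (inc j b))"
        using tv_inc[OF c'(1) b(2)] lin_scal by simp
      then show ?thesis by (simp add: mult.commute)
    qed
    then show ?thesis
      unfolding k scal_sum by (intro submodule_sum lin0 lin_add)
  qed
  have I_ideal: "is_ideal (I b)" for b
  proof -
    have "0 \<in> I b" using Z0 lin0 by (auto simp: I_def intro!: bexI[of _ 0])
    moreover have "a + a' \<in> I b" if a: "a \<in> I b" and a': "a' \<in> I b" for a a'
    proof -
      obtain z z' where "z \<in> Z" "z - a \<odot> tv b \<in> lin (Low (sum_list (tl b)) b)"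
        "z' \<in> Z" "z' - a' \<odot> tv b \<in> lin (Low (sum_list (tl b)) b)"
        using a a' by (auto simp: I_def)
      moreover have "z + z' - (a + a') \<odot> tv b = (z - a \<odot> tv b) + (z' - a' \<odot> tv b)"
        by (auto simp: fun_eq_iff algebra_simps)
      ultimately show ?thesis unfolding I_def using Zadd lin_add by (metis (mono_tags, lifting) mem_Collect_eq)
    qed
    moreover have "r * a \<in> I b" if a: "a \<in> I b" for r a
    proof -
      obtain z where "z \<in> Z" "z - a \<odot> tv b \<in> lin (Low (sum_list (tl b)) b)"
        using a by (auto simp: I_def)
      moreover have "r \<odot> z - (r * a) \<odot> tv b = r \<odot> (z - a \<odot> tv b)"
        by (auto simp: fun_eq_iff algebra_simps)
      ultimately show ?thesis unfolding I_def using Zscal lin_scal by (metis (mono_tags, lifting) mem_Collect_eq)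
    qed
    ultimately show ?thesis by (simp add: is_ideal_def)
  qed
  have I_inc: "I (i # \<alpha>) \<subseteq> I (i # \<alpha>[j := Suc (\<alpha> ! j)])" if "i < r" "length \<alpha> = ?m" "j < ?m" for i \<alpha> j
  proof
    fix a assume "a \<in> I (i # \<alpha>)"
    then obtain z where z: "z \<in> Z" "z - a \<odot> tv (i # \<alpha>) \<in> lin (Low (sum_list \<alpha>) (i # \<alpha>))"
      by (auto simp: I_def)
    have b: "i # \<alpha> \<in> Idx (sum_list \<alpha>)" using that by (simp add: Idx_iff Mon_def)
    have inc: "inc j (i # \<alpha>) = i # \<alpha>[j := Suc (\<alpha> ! j)]" by (simp add: inc_def)
    have "sum_list (\<alpha>[j := Suc (\<alpha> ! j)]) = Suc (sum_list \<alpha>)"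
      using Mon_inc[of \<alpha> "sum_list \<alpha>" j] that by (simp add: Mon_def)
    moreover have "xs ! j \<odot> z - a \<odot> tv (inc j (i # \<alpha>)) = xs ! j \<odot> (z - a \<odot> tv (i # \<alpha>))"
      unfolding tv_inc[OF b that(3), symmetric] by (auto simp: fun_eq_iff algebra_simps)
    ultimately show "a \<in> I (i # \<alpha>[j := Suc (\<alpha> ! j)])"
      using lin_inc[OF z(2) b that(3)] Zscal[OF z(1)] unfolding I_def inc[symmetric]
      by (auto simp: inc intro!: bexI[of _ "xs ! j \<odot> z"])
  qed
  have "\<exists>c. \<forall>\<alpha>. length \<alpha> = ?m \<longrightarrow> I (i # \<alpha>) \<subseteq> I (i # map (min c) \<alpha>)" if "i < r" for i
  proof (rule noetherian_monotone_stable[OF noeth, where F="\<lambda>\<alpha>. I (i # \<alpha>)"])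
    show "I (i # \<alpha>) \<subseteq> I (i # \<beta>)" if "length \<alpha> = ?m" "list_all2 (\<le>) \<alpha> \<beta>" for \<alpha> \<beta>
      by (rule pointwise_mono_from_inc[OF that(2), of "\<lambda>\<alpha>. I (i # \<alpha>)"]) (use I_inc \<open>i < r\<close> that(1) in auto)
  qed (rule I_ideal)
  then obtain f where f: "\<And>i \<alpha>. i < r \<Longrightarrow> length \<alpha> = ?m \<Longrightarrow> I (i # \<alpha>) \<subseteq> I (i # map (min (f i)) \<alpha>)"
    by metis
  define c where "c = Max (insert 0 (f ` {..<r}))"
  have c: "f i \<le> c" if "i < r" for i
    unfolding c_def using that by (intro Max_ge) auto
  have I_dec: "I (i # \<alpha>) \<subseteq> I (i # \<alpha>[j := \<alpha> ! j - 1])"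
    if "i < r" "length \<alpha> = ?m" "j < ?m" "c < \<alpha> ! j" for i \<alpha> j
  proof -
    let ?\<beta> = "\<alpha>[j := \<alpha> ! j - 1]"
    \<comment> \<open>The j-th entry exceeds c and hence \<open>f i\<close>, so it is still at least
      \<open>f i\<close> after the decrement and truncation does not see the change.\<close>
    have "map (min (f i)) \<alpha> = map (min (f i)) ?\<beta>"
      using c[OF that(1)] that by (intro nth_equalityI) (auto simp: nth_list_update min_def)
    moreover have "I (i # map (min (f i)) ?\<beta>) \<subseteq> I (i # ?\<beta>)"
    proof (rule pointwise_mono_from_inc[of _ _ "\<lambda>\<alpha>. I (i # \<alpha>)"])
      show "list_all2 (\<le>) (map (min (f i)) ?\<beta>) ?\<beta>"
        by (auto simp: list_all2_conv_all_nth)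
    qed (use I_inc that in auto)
    ultimately show ?thesis using f[OF that(1,2)] by simp
  qed
  have lin_pow: "z s \<in> ideal_pow q n" if z: "z \<in> lin X" and X: "X \<subseteq> Idx n" for z X n s
  proof -
    obtain k where k: "z = (\<Sum>b\<in>X. k b \<odot> tv b)" using z by (auto simp: lin_def)
    have "tv b s \<in> ideal_pow q n" if "b \<in> X" for b
      using X that mon_in_ideal_pow is_ideal_zero[OF is_ideal_pow] by (fastforce simp: Idx_iff tv_def)
    moreover have "z s = (\<Sum>b\<in>X. k b * tv b s)"
      unfolding k by (rule lin_apply)
    ultimately show ?thesis
      by (simp add: is_ideal_sum[OF is_ideal_pow] is_ideal_mult[OF is_ideal_pow])
  qed
  define good where "good n z \<longleftrightarrow> (\<exists>u. (\<forall>j<?m. u j \<in> Z \<and> (\<forall>s. u j s \<in> ideal_pow q n)) \<and> z = (\<Sum>j<?m. xs ! j \<odot> u j))"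
    for n and z :: "'s \<Rightarrow> 'a"
  \<comment> \<open>Induction on an initial segment of the monomial vectors of degree n + 1; being
    closed downwards, it becomes \<open>Low\<close> of its maximum once the maximum is
    removed.\<close>
  have main: "good n z" if n: "n \<ge> ?m * c" and X: "finite X" "X \<subseteq> Idx (Suc n)"
      "\<forall>b\<in>X. \<forall>b'\<in>Idx (Suc n). b' < b \<longrightarrow> b' \<in> X" and z: "z \<in> Z" "z \<in> lin X" for n X z
    using X z
  proof (induction X arbitrary: z rule: finite_psubset_induct)
    case (psubset X)
    show ?case
    proof (cases "X = {}")
      case True
      then have "z = 0" using psubset.prems by (simp add: lin_def)
      then show ?thesis
        unfolding good_def using Z0 is_ideal_zero[OF is_ideal_pow] by (intro exI[of _ "\<lambda>_. 0"]) auto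
    next
      case False
      define b where "b = Max X"
      have b: "b \<in> X" "\<And>b'. b' \<in> X \<Longrightarrow> b' \<le> b"
        using False psubset.hyps by (auto simp: b_def)
      have "b \<in> Idx (Suc n)" using b(1) psubset.prems(1) by blast
      then obtain i \<alpha> where i: "b = i # \<alpha>" "i < r" "\<alpha> \<in> Mon (Suc n)"
        unfolding Idx_iff by blast
      have Xb: "X - {b} = Low (Suc n) b"
        using b psubset.prems by (auto simp: Low_def le_less)
      have \<alpha>: "length \<alpha> = ?m" "sum_list \<alpha> = Suc n" using i by (auto simp: Mon_def)
      \<comment> \<open>Pigeonhole: the exponents sum to n + 1, which exceeds \<open>?m * c\<close>.
        This is where the threshold comes from.\<close>
      have "\<exists>j<?m. c < \<alpha> ! j"
      proof (rule ccontr)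
        assume "\<not> ?thesis"
        then have "\<And>j. j \<in> {..<?m} \<Longrightarrow> \<alpha> ! j \<le> c"
          by (metis lessThan_iff not_less)
        then have "(\<Sum>j<?m. \<alpha> ! j) \<le> ?m * c"
          using sum_bounded_above[of "{..<?m}" "\<lambda>j. \<alpha> ! j" c] by simp
        then have "sum_list \<alpha> \<le> ?m * c"
          using \<alpha>(1) by (simp add: sum_list_sum_nth atLeast0LessThan)
        then show False using n \<alpha> by simp
      qed
      then obtain j where j: "j < ?m" "c < \<alpha> ! j" by blast
      define \<beta> where "\<beta> = \<alpha>[j := \<alpha> ! j - 1]"
      have \<beta>: "\<beta> \<in> Mon n" "\<alpha> = \<beta>[j := Suc (\<beta> ! j)]"
        unfolding \<beta>_def using Mon_dec[OF i(3) j(1)] j(2) by auto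
      have b\<beta>: "b = inc j (i # \<beta>)" using i \<beta> by (simp add: inc_def)
      have i\<beta>: "i # \<beta> \<in> Idx n" using i \<beta> by (simp add: Idx_iff)
      obtain k where k: "z = (\<Sum>b\<in>X. k b \<odot> tv b)"
        using psubset.prems by (auto simp: lin_def)
      have zk: "z - k b \<odot> tv b = (\<Sum>b\<in>X - {b}. k b \<odot> tv b)"
        unfolding k using sum.remove[OF psubset.hyps b(1), of "\<lambda>b. k b \<odot> tv b"] by simp
      then have low: "z - k b \<odot> tv b \<in> lin (X - {b})" using linI by simp
      then have "k b \<in> I b"
        unfolding I_def using psubset.prems(3) \<alpha> i Xb by auto
      then have "k b \<in> I (i # \<beta>)"
        using I_dec[OF i(2) \<alpha>(1) j] unfolding i(1) \<beta>_def by blast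
      \<comment> \<open>The leading coefficient of z already occurs at the monomial divided by
        \<open>xs ! j\<close>; subtracting \<open>xs ! j\<close> times that element of Z cancels the
        leading term of z.\<close>
      then obtain z' where z': "z' \<in> Z" "z' - k b \<odot> tv (i # \<beta>) \<in> lin (Low n (i # \<beta>))"
        using \<beta>(1) by (auto simp: I_def Mon_def)
      have "xs ! j \<odot> (z' - k b \<odot> tv (i # \<beta>)) \<in> lin (X - {b})"
        using lin_inc[OF z'(2) i\<beta> j(1)] unfolding Xb b\<beta>[symmetric] .
      moreover have "xs ! j \<odot> (z' - k b \<odot> tv (i # \<beta>)) = xs ! j \<odot> z' - k b \<odot> tv b"
        using tv_inc[OF i\<beta> j(1)] unfolding b\<beta>[symmetric]
        by (auto simp: fun_eq_iff algebra_simps)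
      ultimately have "(z - k b \<odot> tv b) - (xs ! j \<odot> z' - k b \<odot> tv b) \<in> lin (X - {b})"
        using lin_diff[OF low] by metis
      moreover have "(z - k b \<odot> tv b) - (xs ! j \<odot> z' - k b \<odot> tv b) = z - xs ! j \<odot> z'"
        by (auto simp: fun_eq_iff)
      ultimately have "z - xs ! j \<odot> z' \<in> lin (X - {b})" by metis
      moreover have "z - xs ! j \<odot> z' \<in> Z"
      proof -
        have "z - xs ! j \<odot> z' = z + (- xs ! j) \<odot> z'" by (auto simp: fun_eq_iff)
        then show ?thesis using Zadd Zscal z'(1) psubset.prems(3) by metis
      qed
      moreover have "\<forall>b1\<in>X - {b}. \<forall>b'\<in>Idx (Suc n). b' < b1 \<longrightarrow> b' \<in> X - {b}"
        using psubset.prems(2) b(2) by fastforce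
      ultimately have "good n (z - xs ! j \<odot> z')"
        using psubset.IH[of "X - {b}"] psubset.prems(1) b(1) by blast
      then obtain u where u: "\<And>j. j < ?m \<Longrightarrow> u j \<in> Z \<and> (\<forall>s. u j s \<in> ideal_pow q n)"
        "z - xs ! j \<odot> z' = (\<Sum>j<?m. xs ! j \<odot> u j)" unfolding good_def by blast
      have z'pow: "z' s \<in> ideal_pow q n" for s
      proof -
        have "z' - k b \<odot> tv (i # \<beta>) \<in> lin (Idx n)" "k b \<odot> tv (i # \<beta>) \<in> lin (Idx n)"
          using z'(2) i\<beta> finIdx by (auto intro!: lin_scal lin_tv intro: lin_mono simp: Low_def)
        then have "z' \<in> lin (Idx n)" using lin_add by fastforce
        then show ?thesis using lin_pow by blast
      qed
      define u' where "u' = (\<lambda>i. if i = j then u i + z' else u i)"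
      have "(\<Sum>i<?m. xs ! i \<odot> (if i = j then u i + z' else u i)) =
          (\<Sum>i<?m. xs ! i \<odot> u i + (if i = j then xs ! i \<odot> z' else 0))"
        by (rule sum.cong) (auto simp: scal_distrib)
      also have "\<dots> = (\<Sum>i<?m. xs ! i \<odot> u i) + xs ! j \<odot> z'"
        unfolding sum.distrib using j(1) by simp
      also have "\<dots> = z" unfolding u(2)[symmetric] by simp
      finally have "z = (\<Sum>i<?m. xs ! i \<odot> (if i = j then u i + z' else u i))" ..
      moreover have "(if i = j then u i + z' else u i) \<in> Z \<and> (\<forall>s. (if i = j then u i + z' else u i) s \<in> ideal_pow q n)"
        if "i < ?m" for i
      proof -
        have "u i + z' \<in> Z"
          using u(1)[OF that] z'(1) by (blast intro: Zadd)
        moreover have "(u i + z') s \<in> ideal_pow q n" for s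
          unfolding plus_fun_apply using u(1)[OF that] z'pow by (blast intro: is_ideal_add[OF is_ideal_pow])
        ultimately show ?thesis using u(1)[OF that] by (cases "i = j") simp_all
      qed
      ultimately have "z = (\<Sum>i<?m. xs ! i \<odot> u' i)"
          and "\<forall>i<?m. u' i \<in> Z \<and> (\<forall>s. u' i s \<in> ideal_pow q n)"
        unfolding u'_def by blast+
      then show ?thesis unfolding good_def by blast
    qed
  qed
  \<comment> \<open>Entries in the n-th power are combinations of monomials of degree n, so z has a
    presentation over the full initial segment \<open>Idx n\<close>, from which \<open>main\<close>
    starts.\<close>
  have Z_lin: "z \<in> lin (Idx n)" if z: "z \<in> Z" and pow: "\<And>s. z s \<in> ideal_pow q n" for z n
  proof -
    have "\<exists>k. z (h i) = (\<Sum>\<alpha>\<in>Mon n. k \<alpha> * mon \<alpha>)" for i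
      using ideal_gen_image_finite[OF finite_Mon] ideal_pow_subset_monomials pow by blast
    then obtain k where k: "\<And>i. z (h i) = (\<Sum>\<alpha>\<in>Mon n. k i \<alpha> * mon \<alpha>)" by metis
    have "z s = (\<Sum>b\<in>Idx n. k (hd b) (tl b) \<odot> tv b) s" for s
    proof -
      have "(\<Sum>b\<in>Idx n. k (hd b) (tl b) \<odot> tv b) s = (\<Sum>b\<in>Idx n. k (hd b) (tl b) * tv b s)"
        by (rule lin_apply)
      also have "\<dots> = (\<Sum>p\<in>{..<r} \<times> Mon n. k (fst p) (snd p) * (if s = h (fst p) then mon (snd p) else 0))"
        unfolding Idx_def by (subst sum.reindex) (auto simp: inj_on_def tv_def case_prod_unfold intro!: sum.cong)
      also have "\<dots> = (\<Sum>i<r. \<Sum>\<alpha>\<in>Mon n. k i \<alpha> * (if s = h i then mon \<alpha> else 0))"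
        unfolding sum.cartesian_product by (simp add: case_prod_unfold)
      also have "\<dots> = (\<Sum>i<r. if s = h i then z s else 0)"
        by (rule sum.cong) (auto simp: k)
      also have "\<dots> = z s"
      proof (cases "s \<in> S")
        case True
        then obtain i where i: "i < r" "s = h i"
          using h unfolding bij_betw_def r_def by blast
        have "(s = h i') = (i' = i)" if "i' < r" for i'
          using h i that unfolding bij_betw_def r_def inj_on_def by auto
        then have "(\<Sum>i'<r. if s = h i' then z s else 0) = (\<Sum>i'<r. if i' = i then z s else 0)"
          by (intro sum.cong) auto
        then show ?thesis using i(1) by simp
      next
        case False
        then have "z s = 0" using ZS[OF z] by blast
        then show ?thesis by (simp only: if_cancel sum.neutral_const)
      qed
      finally show ?thesis ..
    qed
    then have "z = (\<Sum>b\<in>Idx n. k (hd b) (tl b) \<odot> tv b)" by (rule ext)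
    then show ?thesis using linI[of "\<lambda>b. k (hd b) (tl b)" "Idx n"] by simp
  qed
  have "good n z" if "n \<ge> ?m * c" "z \<in> Z" "\<And>s. z s \<in> ideal_pow q (Suc n)" for n z
    using main[OF that(1) finIdx _ _ that(2)] Z_lin[OF that(2,3)] by blast
  then show ?thesis unfolding good_def by blast
qed

end

section \<open>The Rees algebra and the form ring\<close>

context koszul
begin

text \<open>In cone form a cocycle (a, b) satisfies \<open>x l ^ \<nu> l\<close> a = D b, so (b, 0)
  bounds its multiple. What matters is the degree: the primitive lies \<open>\<nu> l\<close> levels
  higher than z.\<close>

lemma multiply_cocycle:
  assumes W: "stable W" and l: "l < m" and z: "z \<in> Coch W {..<m} \<nu> e p" "D {..<m} \<nu> z = 0"
  shows "\<exists>w\<in>Coch W {..<m} \<nu> (e + int (\<nu> l)) (p - 1). x l ^ \<nu> l \<odot> z = D {..<m} \<nu> w"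
proof -
  define J where "J = {..<m} - {l}"
  have J: "finite J" "l \<notin> J" "insert l J = {..<m}" using l by (auto simp: J_def)
  obtain a b where ab: "a \<in> Coch W J \<nu> e p" "b \<in> Coch W J \<nu> (e + int (\<nu> l)) (p - 1)" "z = join l a b"
    using Coch_joinE[OF z(1)[folded J(3)] J(1,2) W] .
  note s = Coch_supp[OF ab(1)] Coch_supp[OF ab(2)]
  have eq: "join l (D J \<nu> a) (x l ^ \<nu> l \<odot> a - D J \<nu> b) = 0"
    using z(2) unfolding ab(3) J(3)[symmetric] D_join[OF J(1,2) s] .
  have "(x l ^ \<nu> l \<odot> a - D J \<nu> b) T = 0" for T
  proof (cases "l \<in> T")
    case True
    then have "\<not> T \<subseteq> J" using J by auto
    moreover have "supp J (x l ^ \<nu> l \<odot> a - D J \<nu> b)" using s by (intro supp_intros)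
    ultimately show ?thesis by (auto simp: supp_def)
  next
    case False
    then have "ksgn l (insert l T) * (x l ^ \<nu> l \<odot> a - D J \<nu> b) T = 0"
      using fun_cong[OF eq, of "insert l T"] by (simp add: join_def)
    then show ?thesis by (metis ksgn_square' mult_zero_right)
  qed
  then have "x l ^ \<nu> l \<odot> a = D J \<nu> b" by (auto simp: fun_eq_iff)
  then have "x l ^ \<nu> l \<odot> z = D {..<m} \<nu> (join l b 0)"
    unfolding ab(3) J(3)[symmetric] D_join[OF J(1,2) s(2) supp_linear(5)]
    by (simp add: join_linear)
  moreover have "join l b 0 \<in> Coch W {..<m} \<nu> (e + int (\<nu> l)) (p - 1)"
    unfolding J(3)[symmetric] using Coch_join_iff[OF J(1,2) s(2) supp_linear(5) W] ab(2) Coch_zero[OF W] by blast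
  ultimately show ?thesis by blast
qed

lemma D_sum: "D J \<nu> (sum f A) = (\<Sum>i\<in>A. D J \<nu> (f i))"
  by (induction A rule: infinite_finite_induct) (simp_all only: simp_thms sum.infinite sum.empty sum.insert D_zero D_add)

end

context ideal_generators
begin

sublocale koszul "\<lambda>j. xs ! j" "length xs" .

lemma ideal_pow_Suc_subset: "ideal_pow q (Suc n) \<subseteq> ideal_pow q n"
  unfolding ideal_pow.simps
  by (rule ideal_gen_least[OF is_ideal_pow]) (auto, metis is_ideal_mult is_ideal_pow mult.commute)

lemma qp_nat: "qp q (int n) = ideal_pow q n"
  by (cases "n = 0") (simp_all add: qp_def)

lemma qp_Suc_subset: "qp q (e + 1) \<subseteq> qp q e"
proof (cases "e \<le> 0")
  case False
  then have "nat (e + 1) = Suc (nat e)" by simp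
  then show ?thesis using False ideal_pow_Suc_subset by (simp add: qp_def)
qed (simp add: qp_def)

lemma is_ideal_UNIV: "is_ideal UNIV"
  by (simp add: is_ideal_def)

lemma stable_qp: "stable (qp q)"
  unfolding stable_def
proof (intro conjI allI impI ballI)
  fix e show "is_ideal (qp q e)" by (simp add: qp_def is_ideal_pow is_ideal_UNIV)
next
  fix e j a assume a: "j < length xs" "a \<in> qp q e"
  show "xs ! j * a \<in> qp q (e + 1)"
  proof (cases "e < 0")
    case False
    then obtain n where e: "e = int n" using nonneg_int_cases by (metis not_less)
    have "xs ! j * a \<in> qp q (int (Suc n))"
      using ideal_pow_mult[of a n j] a unfolding e qp_nat by simp
    then show ?thesis by (simp add: e algebra_simps)
  qed (simp add: qp_def)
qed

lemma stable_qp_shift: "stable (\<lambda>e. qp q (e + 1))"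
  using stable_qp unfolding stable_def by blast

lemma stable_zero: "stable (\<lambda>_. {0})"
  by (simp add: stable_def is_ideal_def)

lemma stable_UNIV: "stable (\<lambda>_. UNIV)"
  by (simp add: stable_def is_ideal_UNIV)

text \<open>\<open>R\<close> is the extended Rees algebra and \<open>G\<close> the form ring.\<close>
sublocale R: graded_koszul "\<lambda>j. xs ! j" "length xs" "qp q" "\<lambda>_. {0}"
  by unfold_locales (fact stable_qp stable_zero)+

sublocale G: graded_koszul "\<lambda>j. xs ! j" "length xs" "qp q" "\<lambda>e. qp q (e + 1)"
  by unfold_locales (fact stable_qp stable_qp_shift)+

definition CC :: "nat \<Rightarrow> int \<Rightarrow> int \<Rightarrow> (nat set \<Rightarrow> 'a) set" where
  "CC n e p = Coch (qp q) {..<length xs} (\<lambda>_. n) e p"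

definition d :: "nat \<Rightarrow> (nat set \<Rightarrow> 'a) \<Rightarrow> nat set \<Rightarrow> 'a" where
  "d n = D {..<length xs} (\<lambda>_. n)"

definition tr :: "nat \<Rightarrow> nat \<Rightarrow> (nat set \<Rightarrow> 'a) \<Rightarrow> nat set \<Rightarrow> 'a" where
  "tr n N = \<Phi> (\<lambda>_. n) (\<lambda>_. N)"

lemma Coch_shift: "Coch (\<lambda>e. qp q (e + 1)) J \<nu> e p = Coch (qp q) J \<nu> (e + 1) p"
  by (simp add: Coch_def algebra_simps)

lemma Coch_const_zero: "Coch (\<lambda>_. {0}) J \<nu> e p = {0}"
  by (auto simp: Coch_def fun_eq_iff)

lemma R_cocyc: "R.cocyc (\<lambda>_. n) e p z \<longleftrightarrow> z \<in> CC n e p \<and> d n z = 0"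
  by (simp add: R.cocyc_def CC_def d_def Coch_const_zero)

lemma R_cobd: "R.cobd (\<lambda>_. n) e p z \<longleftrightarrow> (\<exists>b\<in>CC n e (p - 1). z = d n b)"
  by (simp add: R.cobd_def CC_def d_def Coch_const_zero)

lemma G_cocyc: "G.cocyc (\<lambda>_. n) e p z \<longleftrightarrow> z \<in> CC n e p \<and> d n z \<in> CC n (e + 1) (p + 1)"
  by (simp add: G.cocyc_def CC_def d_def Coch_shift)

lemma G_cobd: "G.cobd (\<lambda>_. n) e p z \<longleftrightarrow> (\<exists>b\<in>CC n e (p - 1). z - d n b \<in> CC n (e + 1) p)"
  by (simp add: G.cobd_def CC_def d_def Coch_shift)

lemma R_vanish: "R.vanish 0 p e \<longleftrightarrow> (\<forall>n\<ge>1. \<forall>z\<in>CC n e p. d n z = 0 \<longrightarrow>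
    (\<exists>N\<ge>n. \<exists>b\<in>CC N e (p - 1). tr n N z = d N b))"
  unfolding R.vanish_def R.vec_simps R_cocyc R_cobd tr_def by blast

lemma G_vanish: "G.vanish 0 p e \<longleftrightarrow> (\<forall>n\<ge>1. \<forall>z\<in>CC n e p. d n z \<in> CC n (e + 1) (p + 1) \<longrightarrow>
    (\<exists>N\<ge>n. \<exists>b\<in>CC N e (p - 1). tr n N z - d N b \<in> CC N (e + 1) p))"
  unfolding G.vanish_def G.vec_simps G_cocyc G_cobd tr_def by blast

lemmas CC_linear = Coch_zero[OF stable_qp, of "{..<length xs}" "\<lambda>_. n" for n, folded CC_def]
  Coch_add[OF stable_qp, of _ "{..<length xs}" "\<lambda>_. n" for n, folded CC_def]
  Coch_diff[OF stable_qp, of _ "{..<length xs}" "\<lambda>_. n" for n, folded CC_def]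
  Coch_uminus[OF stable_qp, of _ "{..<length xs}" "\<lambda>_. n" for n, folded CC_def]

lemma CC_mono: "e' \<le> e \<Longrightarrow> c \<in> CC n e p \<Longrightarrow> c \<in> CC n e' p"
proof -
  assume "e' \<le> e" "c \<in> CC n e p"
  moreover have "qp q (f + int i) \<subseteq> qp q f" for f i
  proof (induction i)
    case (Suc i)
    then show ?case using qp_Suc_subset[of "f + int i"] by (simp add: algebra_simps)
  qed simp
  from this[of _ "nat (e - e')"] have "qp q (f + (e - e')) \<subseteq> qp q f" for f
    using \<open>e' \<le> e\<close> by simp
  from this[of "e' + _"] have "qp q (e + f) \<subseteq> qp q (e' + f)" for f
    by (metis add.commute add.left_commute diff_add_cancel)
  ultimately show ?thesis unfolding CC_def Coch_def by blast
qed

lemma d_CC: "c \<in> CC n e (p - 1) \<Longrightarrow> d n c \<in> CC n e p"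
  using R.U_D[of "{..<length xs}"] by (simp add: CC_def d_def)

lemma d_d: "c \<in> CC n e p \<Longrightarrow> d n (d n c) = 0"
  unfolding CC_def d_def by (rule D_D) (auto intro: Coch_supp)

lemma d_linear: "d n (a - b) = d n a - d n b" "d n (a + b) = d n a + d n b" "d n (- a) = - d n a" "d n 0 = 0"
  by (simp_all add: d_def D_linear)

lemma tr_linear: "tr n N (a - b) = tr n N a - tr n N b" "tr n N (a + b) = tr n N a + tr n N b"
    "tr n N (- a) = - tr n N a" "tr n N 0 = 0"
  by (simp_all add: tr_def \<Phi>_linear)

lemma tr_same [simp]: "tr n n c = c"
  by (simp add: tr_def)

lemma tr_CC: "n \<le> N \<Longrightarrow> c \<in> CC n e p \<Longrightarrow> tr n N c \<in> CC N e p"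
  unfolding CC_def tr_def by (rule \<Phi>_Coch[OF stable_qp]) auto

lemma d_tr: "n \<le> N \<Longrightarrow> d N (tr n N c) = tr n N (d n c)"
  unfolding d_def tr_def by (rule \<Phi>_D) auto

lemma tr_tr: "n \<le> N \<Longrightarrow> N \<le> N' \<Longrightarrow> c \<in> CC n e p \<Longrightarrow> tr N N' (tr n N c) = tr n N' c"
  unfolding tr_def CC_def by (rule \<Phi>_comp[of "{..<length xs}"]) (auto intro: Coch_supp)

text \<open>Artin-Rees for the module of cocycles over A writes a deep cocycle as a sum of
  \<open>xs ! j\<close> times cocycles one level less deep; \<open>multiply_cocycle\<close> bounds
  each summand and regains the lost level.\<close>

lemma Rees_Koszul_vanish_large:
  "\<exists>e0. \<forall>e\<ge>e0. \<forall>z. R.cocyc (\<lambda>_. 1) e (int p) z \<longrightarrow> R.cobd (\<lambda>_. 1) e (int p) z"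
proof -
  define Z where "Z = {z \<in> Coch (\<lambda>_. UNIV) {..<length xs} (\<lambda>_. 1) 0 (int p). d 1 z = 0}"
  have "\<exists>c. \<forall>n\<ge>c. \<forall>z\<in>Z. (\<forall>s. z s \<in> ideal_pow q (Suc n)) \<longrightarrow>
      (\<exists>u. (\<forall>j<length xs. u j \<in> Z \<and> (\<forall>s. u j s \<in> ideal_pow q n)) \<and> z = (\<Sum>j<length xs. xs ! j \<odot> u j))"
  proof (rule Artin_Rees[of Z "Pow {..<length xs}"])
    show "0 \<in> Z"
      unfolding Z_def using Coch_zero[OF stable_UNIV] d_linear by simp
    show "z + w \<in> Z" if "z \<in> Z" "w \<in> Z" for z w
      using that Coch_add[OF stable_UNIV] unfolding Z_def by (simp add: d_linear)
    show "r \<odot> z \<in> Z" if "z \<in> Z" for r z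
      using that Coch_scal[OF stable_UNIV] unfolding Z_def by (simp add: d_def D_scal)
    show "z s = 0" if "z \<in> Z" "s \<notin> Pow {..<length xs}" for z s
      using that unfolding Z_def Coch_def by auto
  qed simp
  then obtain c where c: "\<And>n z. n \<ge> c \<Longrightarrow> z \<in> Z \<Longrightarrow> (\<And>s. z s \<in> ideal_pow q (Suc n)) \<Longrightarrow>
      \<exists>u. (\<forall>j<length xs. u j \<in> Z \<and> (\<forall>s. u j s \<in> ideal_pow q n)) \<and> z = (\<Sum>j<length xs. xs ! j \<odot> u j)"
    by blast
  \<comment> \<open>With exponent 1 the entries in cohomological degree p lie in the power e + p.
    This has to be n + 1 with n at least c, whence the bound on e.\<close>
  have "R.cobd (\<lambda>_. 1) e (int p) z" if e: "e \<ge> int c + 1 - int p" and z: "R.cocyc (\<lambda>_. 1) e (int p) z" for e z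
  proof -
    define n where "n = nat (e + int p - 1)"
    have n: "n \<ge> c" "e + int p = int (Suc n)" "e - 1 + int p = int n" using e by (auto simp: n_def)
    have z': "z \<in> CC 1 e (int p)" "d 1 z = 0" using z by (auto simp: R_cocyc)
    have zs: "z s \<in> ideal_pow q (Suc n)" for s
    proof (cases "z s = 0")
      case True
      then show ?thesis using is_ideal_zero[OF is_ideal_pow, of "Suc n"] by simp
    next
      case False
      then have "z s \<in> qp q (e + int p)" using z'(1) by (auto simp: CC_def Coch_def)
      then show ?thesis unfolding n(2) qp_nat .
    qed
    have "z \<in> Z" using z' by (auto simp: Z_def CC_def Coch_def)
    from c[OF n(1) this zs] obtain u where
      u: "\<And>j. j < length xs \<Longrightarrow> u j \<in> Z \<and> (\<forall>s. u j s \<in> ideal_pow q n)" "z = (\<Sum>j<length xs. xs ! j \<odot> u j)"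
      by blast
    have "\<exists>w\<in>CC 1 e (int p - 1). xs ! j \<odot> u j = d 1 w" if j: "j < length xs" for j
    proof -
      have "u j s \<in> qp q (e - 1 + int (\<Sum>i\<in>s. 1))" for s
      proof (cases "u j s = 0")
        case True
        then show ?thesis using is_ideal_zero[OF stable_ideal[OF stable_qp]] by simp
      next
        case False
        then have "int (\<Sum>i\<in>s. 1) = int p" using u(1)[OF j] by (auto simp: Z_def Coch_def)
        then have "e - 1 + int (\<Sum>i\<in>s. 1) = int n" using n(3) by simp
        then show ?thesis using u(1)[OF j] by (simp only: qp_nat)
      qed
      then have "u j \<in> Coch (qp q) {..<length xs} (\<lambda>_. 1) (e - 1) (int p)" "d 1 (u j) = 0"
        using u(1)[OF j] by (auto simp: Z_def Coch_def)
      then show ?thesis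
        using multiply_cocycle[OF stable_qp j, of "u j" "\<lambda>_. 1" "e - 1" "int p"] by (simp add: CC_def d_def)
    qed
    then obtain w where w: "\<And>j. j < length xs \<Longrightarrow> w j \<in> CC 1 e (int p - 1)"
      "\<And>j. j < length xs \<Longrightarrow> xs ! j \<odot> u j = d 1 (w j)" by metis
    have "z = d 1 (\<Sum>j<length xs. w j)"
      unfolding u(2) d_def D_sum by (rule sum.cong) (use w(2) in \<open>auto simp: d_def\<close>)
    moreover have "(\<Sum>j<length xs. w j) \<in> CC 1 e (int p - 1)"
      by (rule submodule_sum) (use w(1) CC_linear in auto)
    ultimately show ?thesis by (auto simp: R_cobd)
  qed
  then show ?thesis by blast
qed

lemma R_vanish_large: "\<exists>e0. \<forall>e\<ge>e0. R.vanish 0 p e"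
proof (cases "p < 0")
  case True
  then show ?thesis using R.vanish_neg by blast
next
  case False
  then obtain n where "p = int n" using nonneg_int_cases by (metis not_less)
  then show ?thesis using Rees_Koszul_vanish_large[of n] R.vanish_from_ones by metis
qed

text \<open>Exactness in the middle for the sequence F^(e+1) -> F^e -> G_e: a class that vanishes in
  G comes from level e + 1, where it dies.\<close>

lemma R_vanish_step:
  assumes R: "R.vanish 0 p (e + 1)" and G: "G.vanish 0 p e"
  shows "R.vanish 0 p e"
  unfolding R_vanish
proof (intro allI impI ballI)
  fix n z assume n: "n \<ge> 1" and z: "z \<in> CC n e p" "d n z = 0"
  then obtain N b where N: "N \<ge> n" "b \<in> CC N e (p - 1)" "tr n N z - d N b \<in> CC N (e + 1) p"
    using G CC_linear(1) unfolding G_vanish by metis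
  have "d N (tr n N z - d N b) = 0"
    using z N by (simp add: d_linear d_tr tr_linear d_d)
  then obtain N' b' where N': "N' \<ge> N" "b' \<in> CC N' (e + 1) (p - 1)" "tr N N' (tr n N z - d N b) = d N' b'"
    using R N n unfolding R_vanish by (metis le_trans)
  have "tr n N' z = tr N N' (tr n N z - d N b) + tr N N' (d N b)"
    using tr_tr[OF N(1) N'(1) z(1)] by (simp add: tr_linear)
  also have "\<dots> = d N' (b' + tr N N' b)"
    using N' by (simp add: d_linear d_tr)
  finally have "tr n N' z = d N' (b' + tr N N' b)" .
  moreover have "b' + tr N N' b \<in> CC N' e (p - 1)"
    using CC_mono[OF _ N'(2), of e] tr_CC[OF N'(1) N(2)] CC_linear by simp
  ultimately show "\<exists>N\<ge>n. \<exists>b\<in>CC N e (p - 1). tr n N z = d N b"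
    using N(1) N'(1) le_trans by blast
qed

text \<open>Descending induction on the level, started where Artin-Rees gives vanishing.\<close>

lemma R_vanish_above:
  assumes "\<And>e'. e' \<ge> e \<Longrightarrow> G.vanish 0 p e'"
  shows "R.vanish 0 p e"
proof -
  obtain e0 where e0: "\<And>e. e \<ge> e0 \<Longrightarrow> R.vanish 0 p e" using R_vanish_large by blast
  have "R.vanish 0 p (max e e0 - int i)" if "int i \<le> max e e0 - e" for i
    using that
  proof (induction i)
    case 0
    show ?case by (rule e0) simp
  next
    case (Suc i)
    have "R.vanish 0 p (max e e0 - int i)" using Suc by simp
    moreover have "max e e0 - int (Suc i) + 1 = max e e0 - int i" by simp
    moreover have "G.vanish 0 p (max e e0 - int (Suc i))"
      by (rule assms) (use Suc.prems in linarith)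
    ultimately show ?case by (metis R_vanish_step)
  qed
  from this[of "nat (max e e0 - e)"] show ?thesis by simp
qed

text \<open>At each level f the symbol of z is a cocycle over G and becomes a coboundary at a later
  stage; subtracting that coboundary gains one level. Assuming only that d z lies at level e1 makes
  this applicable to bounding cochains as well as to cocycles.\<close>

lemma raise_filtration:
  assumes "\<And>f. e \<le> f \<Longrightarrow> f < e1 \<Longrightarrow> G.vanish 0 p f" and "e \<le> e1" "n \<ge> 1"
    and "z \<in> CC n e p" "d n z \<in> CC n e1 (p + 1)"
  shows "\<exists>N\<ge>n. \<exists>z'\<in>CC N e1 p. \<exists>b\<in>CC N e (p - 1). tr n N z = z' + d N b"
  using assms
proof (induction "nat (e1 - e)" arbitrary: e n z)
  case 0
  then have "e = e1" by simp
  moreover have "tr n n z = z + d n 0" by (simp add: d_linear)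
  ultimately show ?case
    using 0 CC_linear(1) by blast
next
  case (Suc i)
  then have e: "e < e1" by simp
  have "d n z \<in> CC n (e + 1) (p + 1)" using CC_mono[of "e + 1" e1] e Suc.prems(5) by simp
  then obtain N b where N: "N \<ge> n" "b \<in> CC N e (p - 1)" "tr n N z - d N b \<in> CC N (e + 1) p"
    using Suc.prems(1)[of e] Suc.prems(3,4) e unfolding G_vanish by blast
  have "d N (tr n N z - d N b) = tr n N (d n z)"
    using N d_d by (simp add: d_linear d_tr)
  then have "d N (tr n N z - d N b) \<in> CC N e1 (p + 1)" using tr_CC[OF N(1) Suc.prems(5)] by simp
  moreover have "i = nat (e1 - (e + 1))" using Suc.hyps(2) by simp
  ultimately obtain N' z' b' where N': "N' \<ge> N" "z' \<in> CC N' e1 p" "b' \<in> CC N' (e + 1) (p - 1)"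
    "tr N N' (tr n N z - d N b) = z' + d N' b'"
    using Suc.hyps(1)[of "e + 1" N "tr n N z - d N b"] Suc.prems(1,3) N e by auto
  have "tr n N' z = tr N N' (tr n N z - d N b) + tr N N' (d N b)"
    using tr_tr[OF N(1) N'(1) Suc.prems(4)] by (simp add: tr_linear)
  also have "\<dots> = z' + d N' (b' + tr N N' b)"
    using N' by (simp add: d_linear d_tr add.assoc)
  finally have "tr n N' z = z' + d N' (b' + tr N N' b)" .
  moreover have "b' + tr N N' b \<in> CC N' e (p - 1)"
    using CC_mono[OF _ N'(3), of e] tr_CC[OF N'(1) N(2)] CC_linear by simp
  ultimately show ?case
    using N(1) N'(1,2) le_trans by blast
qed

text \<open>The same gain of levels with the exponent fixed at 1, fed by vanishing of Koszul rather
  than local cohomology of G.\<close>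

lemma raise_filtration_Koszul:
  assumes "\<And>f z. e \<le> f \<Longrightarrow> f < e1 \<Longrightarrow> G.cocyc (\<lambda>_. 1) f p z \<Longrightarrow> G.cobd (\<lambda>_. 1) f p z" and "e \<le> e1"
    and "z \<in> CC 1 e p" "d 1 z = 0"
  shows "\<exists>z'\<in>CC 1 e1 p. \<exists>b\<in>CC 1 e (p - 1). z = z' + d 1 b"
  using assms
proof (induction "nat (e1 - e)" arbitrary: e z)
  case 0
  then have "e = e1" by simp
  moreover have "z = z + d 1 0" by (simp add: d_linear)
  ultimately show ?case
    using 0 CC_linear(1) by blast
next
  case (Suc i)
  then have e: "e < e1" by simp
  have "G.cobd (\<lambda>_. 1) e p z"
    using Suc.prems e CC_linear(1) by (simp add: G_cocyc)
  then obtain b where b: "b \<in> CC 1 e (p - 1)" "z - d 1 b \<in> CC 1 (e + 1) p" by (auto simp: G_cobd)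
  have "d 1 (z - d 1 b) = 0"
    using b d_d Suc.prems(4) by (simp add: d_linear)
  moreover have "i = nat (e1 - (e + 1))" using Suc.hyps(2) by simp
  ultimately obtain z' b' where z': "z' \<in> CC 1 e1 p" "b' \<in> CC 1 (e + 1) (p - 1)" "z - d 1 b = z' + d 1 b'"
    using Suc.hyps(1)[of "e + 1" "z - d 1 b"] Suc.prems(1) b(2) e by auto
  then have "z = z' + d 1 (b' + b)"
    by (metis add.assoc d_linear(2) diff_add_cancel)
  moreover have "b' + b \<in> CC 1 e (p - 1)"
    using CC_mono[OF _ z'(2), of e] b(1) CC_linear by simp
  ultimately show ?case using z'(1) by blast
qed

text \<open>Each cochain over A has some level e, because powers with exponent at most 0 are the
  whole ring. The level f of the preimage and of the coboundary is left free; one f serves both, as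
  levels decrease under inclusion.\<close>

definition surj_A :: "int \<Rightarrow> bool" where
  "surj_A i \<longleftrightarrow> (\<forall>n\<ge>1. \<forall>e. \<forall>z\<in>CC n e i. d n z = 0 \<longrightarrow>
    (\<exists>f. \<exists>w\<in>CC 1 f i. d 1 w = 0 \<and> (\<exists>N\<ge>n. \<exists>b\<in>CC N f (i - 1). tr 1 N w - tr n N z = d N b)))"

definition surj_G :: "int \<Rightarrow> bool" where
  "surj_G i \<longleftrightarrow> (\<forall>n\<ge>1. \<forall>e. \<forall>z\<in>CC n e i. d n z \<in> CC n (e + 1) (i + 1) \<longrightarrow>
    (\<exists>w\<in>CC 1 e i. d 1 w \<in> CC 1 (e + 1) (i + 1) \<and>
      (\<exists>N\<ge>n. \<exists>b\<in>CC N e (i - 1). tr 1 N w - tr n N z - d N b \<in> CC N (e + 1) i)))"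

section \<open>The two implications\<close>

context
  fixes k t :: int
  assumes below: "\<And>i e. 0 \<le> i \<Longrightarrow> i < t \<Longrightarrow> e + i \<noteq> k - 1 \<Longrightarrow> e + i \<noteq> k \<Longrightarrow> G.vanish 0 i e"
    and top: "\<And>e. 0 \<le> t \<Longrightarrow> e + t > k \<Longrightarrow> G.vanish 0 t e"
begin

lemma form_ring_vanish: "G.vanish 0 i e" if "i < t" "e + i \<noteq> k - 1" "e + i \<noteq> k"
  using that below G.vanish_neg by (cases "i < 0") auto

lemma Rees_vanish: "R.vanish 0 i e" if "i \<le> t" "e + i > k"
proof (cases "i < 0")
  case True
  then show ?thesis by (rule R.vanish_neg)
next
  case False
  show ?thesis
  proof (rule R_vanish_above)
    show "G.vanish 0 i e'" if "e' \<ge> e" for e'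
      using that \<open>i \<le> t\<close> \<open>e + i > k\<close> False top[of e'] below[of i e'] by (cases "i = t") auto
  qed
qed

lemma Rees_Koszul_surj:
  assumes i: "i < t" and e: "e + i = k" and n: "n \<ge> 1" and z: "z \<in> CC n e i" "d n z = 0"
  shows "\<exists>N\<ge>n. \<exists>w\<in>CC 1 e i. d 1 w = 0 \<and> (\<exists>b\<in>CC N e (i - 1). tr 1 N w - tr n N z = d N b)"
proof -
  have "R.vanish 0 j (k + 1 - j)" if "0 \<le> j" "j \<le> i" for j
    using that i by (intro Rees_vanish) auto
  from R.Koszul_surj[of i "k + 1", OF this, of e n z] show ?thesis
    using e n z unfolding R_cocyc R_cobd tr_def by (auto simp: algebra_simps)
qed

lemma Rees_Koszul_vanish:
  assumes i: "i \<le> t" and e: "e + i = k + 1" and z: "z \<in> CC 1 e i" "d 1 z = 0"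
  shows "\<exists>b\<in>CC 1 e (i - 1). z = d 1 b"
proof -
  have "R.vanish 0 j (k + 1 - j)" if "0 \<le> j" "j \<le> i" for j
    using that i by (intro Rees_vanish) auto
  from R.Koszul_vanish[of i "k + 1", OF this, of e z] show ?thesis
    using e z unfolding R_cocyc R_cobd by (auto simp: algebra_simps)
qed

lemma form_ring_Koszul_vanish:
  assumes i: "i < t" and e: "e + i < k - 1" and z: "G.cocyc (\<lambda>_. 1) e i z"
  shows "G.cobd (\<lambda>_. 1) e i z"
  by (rule G.Koszul_vanish[of i "e + i"]) (use assms form_ring_vanish in auto)

text \<open>The obstruction d z is a Rees cocycle at (i + 1, e + 1), hence strictly above the
  diagonal k, and so dies at a later stage. The correction v lies at level e + 1 and does not change
  the symbol of z.\<close>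

lemma lift_cocycle:
  assumes i: "i < t" and e: "e + i \<ge> k - 1" and n: "n \<ge> 1" and z: "z \<in> CC n e i" "d n z \<in> CC n (e + 1) (i + 1)"
  shows "\<exists>N\<ge>n. \<exists>v\<in>CC N (e + 1) i. d N (tr n N z - v) = 0"
proof -
  have "R.vanish 0 (i + 1) (e + 1)" by (rule Rees_vanish) (use i e in auto)
  then obtain N v where "N \<ge> n" "v \<in> CC N (e + 1) i" "tr n N (d n z) = d N v"
    using n z d_d[OF z(1)] unfolding R_vanish by (metis add_diff_cancel_right')
  then show ?thesis by (auto simp: d_linear d_tr intro!: exI[of _ N] bexI[of _ v])
qed

text \<open>Surjectivity over G is used on the diagonal k - 1 alone; the error it leaves lies on the
  diagonal k, where the Rees complexes have surjectivity unconditionally.\<close>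

lemma surj_A_if_surj_G:
  assumes i: "i < t" and G: "surj_G i"
  shows "surj_A i"
  unfolding surj_A_def
proof (intro allI impI ballI)
  fix n e z assume n: "n \<ge> 1" and z: "z \<in> CC n e i" "d n z = 0"
  \<comment> \<open>\<open>e1\<close> is the level of degree i on the diagonal k - 1. A cocycle
    lying deeper is merely regarded at level \<open>e1\<close>; otherwise it is raised to
    it.\<close>
  define e1 where "e1 = k - 1 - i"
  define e0 where "e0 = min e e1"
  have z0: "z \<in> CC n e0 i" using CC_mono[OF _ z(1)] by (simp add: e0_def)
  have "\<exists>N\<ge>n. \<exists>z'\<in>CC N e1 i. \<exists>b\<in>CC N e0 (i - 1). tr n N z = z' + d N b"
    by (rule raise_filtration[OF _ _ n z0]) (use i form_ring_vanish z(2) CC_linear(1) in \<open>auto simp: e0_def e1_def\<close>)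
  then obtain N z' b where N: "N \<ge> n" "z' \<in> CC N e1 i" "b \<in> CC N e0 (i - 1)" "tr n N z = z' + d N b" by blast
  have z': "d N z' = 0"
  proof -
    have "d N z' = d N (tr n N z - d N b)" using N(4) by simp
    then show ?thesis using d_d[OF N(3)] d_tr[OF N(1)] z(2) by (simp add: d_linear tr_linear)
  qed
  have "N \<ge> 1" using n N(1) by simp
  then obtain w N1 b1 where w: "w \<in> CC 1 e1 i" "d 1 w \<in> CC 1 (e1 + 1) (i + 1)"
    "N1 \<ge> N" "b1 \<in> CC N1 e1 (i - 1)" "tr 1 N1 w - tr N N1 z' - d N1 b1 \<in> CC N1 (e1 + 1) i"
    using G N(2) z' CC_linear(1) unfolding surj_G_def by metis
  \<comment> \<open>d w sits at (i + 1, e1 + 1), on the diagonal k + 1, where Koszul cohomology of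
    the Rees algebra vanishes; w - v is then a cocycle over A.\<close>
  have "\<exists>v\<in>CC 1 (e1 + 1) (i + 1 - 1). d 1 w = d 1 v"
    by (rule Rees_Koszul_vanish) (use i w d_d in \<open>auto simp: e1_def\<close>)
  then obtain v where v: "v \<in> CC 1 (e1 + 1) i" "d 1 w = d 1 v" by auto
  have N1: "1 \<le> N1" using \<open>N \<ge> 1\<close> w(3) by simp
  \<comment> \<open>The remaining error is a cocycle over A at level \<open>e1 + 1\<close>; it is
    matched by a Koszul cocycle \<open>w2\<close>, and w - v - w2 is the preimage sought.\<close>
  let ?u = "tr 1 N1 w - tr N N1 z' - d N1 b1 - tr 1 N1 v"
  have u: "?u \<in> CC N1 (e1 + 1) i" using CC_linear(3)[OF w(5) tr_CC[OF N1 v(1)]] .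
  have du: "d N1 ?u = 0"
    using w v z' N1 by (simp add: d_linear d_tr d_d tr_linear)
  obtain N2 w2 b2 where w2: "N2 \<ge> N1" "w2 \<in> CC 1 (e1 + 1) i" "d 1 w2 = 0" "b2 \<in> CC N2 (e1 + 1) (i - 1)"
    "tr 1 N2 w2 - tr N1 N2 ?u = d N2 b2"
    using Rees_Koszul_surj[OF i _ N1 u du] by (auto simp: e1_def)
  have e01: "e0 \<le> e1" by (simp add: e0_def)
  have W: "w - v - w2 \<in> CC 1 e0 i"
    by (intro CC_linear(3) CC_mono[OF e01 w(1)] CC_mono[OF _ v(1)] CC_mono[OF _ w2(2)]) (use e01 in simp_all)
  have dW: "d 1 (w - v - w2) = 0" using v w2 by (simp add: d_linear)
  have N12: "N \<le> N2" "n \<le> N2" "n \<le> N1" using N w w2 by auto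
  have "tr N1 N2 ?u = tr 1 N2 w - tr N N2 z' - d N2 (tr N1 N2 b1) - tr 1 N2 v"
    using tr_tr[OF N1 w2(1) w(1)] tr_tr[OF w(3) w2(1) N(2)] tr_tr[OF N1 w2(1) v(1)] d_tr[OF w2(1)]
    by (simp add: tr_linear)
  moreover have "tr n N2 z = tr N N2 z' + d N2 (tr N N2 b)"
    using tr_tr[OF N(1) N12(1) z(1)] N(4) d_tr[OF N12(1)] by (simp add: tr_linear)
  ultimately have "tr 1 N2 (w - v - w2) - tr n N2 z = d N2 (tr N1 N2 b1 - b2 - tr N N2 b)"
    unfolding d_linear w2(5)[symmetric] by (simp add: tr_linear algebra_simps)
  moreover have "tr N1 N2 b1 - b2 - tr N N2 b \<in> CC N2 e0 (i - 1)"
    by (intro CC_linear(3) CC_mono[OF e01 tr_CC[OF w2(1) w(4)]] CC_mono[OF _ w2(4)] tr_CC[OF N12(1) N(3)])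
      (use e01 in simp)
  ultimately show "\<exists>f. \<exists>w\<in>CC 1 f i. d 1 w = 0 \<and> (\<exists>N\<ge>n. \<exists>b\<in>CC N f (i - 1). tr 1 N w - tr n N z = d N b)"
    using W dW N12(2) by blast
qed

text \<open>Only on the diagonal k - 1 does the hypothesis on A enter: elsewhere local cohomology of
  G is zero or the Rees complexes already give surjectivity.\<close>

lemma surj_G_if_surj_A:
  assumes i: "i < t" and A: "surj_A i"
  shows "surj_G i"
  unfolding surj_G_def
proof (intro allI impI ballI)
  fix n e z assume n: "n \<ge> 1" and z: "z \<in> CC n e i" "d n z \<in> CC n (e + 1) (i + 1)"
  consider "e + i \<noteq> k - 1" "e + i \<noteq> k" | "e + i = k" | "e + i = k - 1" by blast
  then show "\<exists>w\<in>CC 1 e i. d 1 w \<in> CC 1 (e + 1) (i + 1) \<and>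
      (\<exists>N\<ge>n. \<exists>b\<in>CC N e (i - 1). tr 1 N w - tr n N z - d N b \<in> CC N (e + 1) i)"
  proof cases
    case 1
    then obtain N b where N: "N \<ge> n" "b \<in> CC N e (i - 1)" "tr n N z - d N b \<in> CC N (e + 1) i"
      using form_ring_vanish[OF i] n z unfolding G_vanish by blast
    have "tr 1 N 0 - tr n N z - d N (- b) = - (tr n N z - d N b)"
      by (simp add: tr_linear d_linear)
    then have "tr 1 N 0 - tr n N z - d N (- b) \<in> CC N (e + 1) i"
      using CC_linear(4)[OF N(3)] by metis
    moreover have "d 1 0 \<in> CC 1 (e + 1) (i + 1)" using d_linear(4) CC_linear(1) by simp
    ultimately show ?thesis using N(1) CC_linear(4)[OF N(2)] CC_linear(1) by blast
  next
    case 2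
    then obtain N v where N: "N \<ge> n" "v \<in> CC N (e + 1) i" "d N (tr n N z - v) = 0"
      using lift_cocycle[OF i _ n z] by auto
    have N1: "N \<ge> 1" using n N by simp
    have zv: "tr n N z - v \<in> CC N e i"
      using CC_linear(3)[OF tr_CC[OF N(1) z(1)] CC_mono[OF _ N(2)]] by simp
    obtain N' w b where w: "N' \<ge> N" "w \<in> CC 1 e i" "d 1 w = 0" "b \<in> CC N' e (i - 1)"
      "tr 1 N' w - tr N N' (tr n N z - v) = d N' b"
      using Rees_Koszul_surj[OF i 2 N1 zv N(3)] by blast
    have "tr 1 N' w - tr n N' z - d N' b = - tr N N' v"
      unfolding w(5)[symmetric] using tr_tr[OF N(1) w(1) z(1)] by (simp add: tr_linear)
    then have "tr 1 N' w - tr n N' z - d N' b \<in> CC N' (e + 1) i"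
      using CC_linear(4)[OF tr_CC[OF w(1) N(2)]] by simp
    moreover have "d 1 w \<in> CC 1 (e + 1) (i + 1)" using w(3) CC_linear(1) by simp
    moreover have "n \<le> N'" using N(1) w(1) by simp
    ultimately show ?thesis using w(2,4) by blast
  next
    case 3
    then obtain N v where N: "N \<ge> n" "v \<in> CC N (e + 1) i" "d N (tr n N z - v) = 0"
      using lift_cocycle[OF i _ n z] by auto
    have N1: "N \<ge> 1" using n N by simp
    have zv: "tr n N z - v \<in> CC N e i"
      using CC_linear(3)[OF tr_CC[OF N(1) z(1)] CC_mono[OF _ N(2)]] by simp
    obtain f w N' b where w: "w \<in> CC 1 f i" "d 1 w = 0" "N' \<ge> N" "b \<in> CC N' f (i - 1)"
      "tr 1 N' w - tr N N' (tr n N z - v) = d N' b"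
      using A N1 zv N(3) unfolding surj_A_def by blast
    define g where "g = min f e"
    have g: "g \<le> f" "g \<le> e" by (auto simp: g_def)
    \<comment> \<open>Every level below e lies under the diagonal k - 1 in degree i, where Koszul
      cohomology of G vanishes.\<close>
    have "\<exists>w'\<in>CC 1 e i. \<exists>c\<in>CC 1 g (i - 1). w = w' + d 1 c"
      by (rule raise_filtration_Koszul[OF _ g(2) CC_mono[OF g(1) w(1)] w(2)]) (use form_ring_Koszul_vanish i 3 in auto)
    then obtain w' c where w': "w' \<in> CC 1 e i" "c \<in> CC 1 g (i - 1)" "w = w' + d 1 c" by blast
    have dw': "d 1 w' = 0" using w(2) d_d[OF w'(2)] unfolding w'(3) by (simp add: d_linear)
    have N'1: "1 \<le> N'" using N1 w(3) by simp
    \<comment> \<open>The coboundary is corrected for the replacement of w by w'. Its differential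
      now lies at level e, although b' itself may still be at the lower level g.\<close>
    define b' where "b' = b - tr 1 N' c"
    have b': "b' \<in> CC N' g (i - 1)"
      unfolding b'_def using CC_linear(3)[OF CC_mono[OF g(1) w(4)] tr_CC[OF N'1 w'(2)]] .
    have db': "d N' b' = tr 1 N' w' - tr N N' (tr n N z - v)"
      unfolding b'_def d_linear w(5)[symmetric] w'(3) using d_tr[OF N'1] by (simp add: tr_linear)
    then have "d N' b' \<in> CC N' e (i - 1 + 1)"
      using CC_linear(3)[OF tr_CC[OF N'1 w'(1)] tr_CC[OF w(3) zv]] by simp
    \<comment> \<open>In degree i - 1 the levels below e lie under the diagonal k - 2, so both
      exceptional diagonals are avoided.\<close>
    moreover have "G.vanish 0 (i - 1) f'" if "g \<le> f'" "f' < e" for f'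
      using that i 3 by (intro form_ring_vanish) auto
    ultimately obtain N2 b2 c2 where N2: "N2 \<ge> N'" "b2 \<in> CC N2 e (i - 1)" "c2 \<in> CC N2 g (i - 1 - 1)"
      "tr N' N2 b' = b2 + d N2 c2"
      using raise_filtration[OF _ g(2) N'1 b'] by blast
    have N2': "N \<le> N2" "n \<le> N2" using N w N2 by auto
    have "d N2 b2 = d N2 (tr N' N2 b' - d N2 c2)" using N2(4) by simp
    also have "\<dots> = tr 1 N2 w' - tr n N2 z + tr N N2 v"
      using d_d[OF N2(3)] d_tr[OF N2(1), of b'] tr_tr[OF N'1 N2(1) w'(1)] tr_tr[OF w(3) N2(1) zv] tr_tr[OF N(1) N2'(1) z(1)]
      by (simp add: d_linear db' tr_linear)
    finally have "tr 1 N2 w' - tr n N2 z - d N2 b2 = - tr N N2 v" by simp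
    then have "tr 1 N2 w' - tr n N2 z - d N2 b2 \<in> CC N2 (e + 1) i"
      using CC_linear(4)[OF tr_CC[OF N2'(1) N(2)]] by simp
    moreover have "d 1 w' \<in> CC 1 (e + 1) (i + 1)" using dw' CC_linear(1) by simp
    ultimately show ?thesis using w'(1) N2(2) N2'(2) by blast
  qed
qed

end

section \<open>Translation to the notions of the theorem\<close>

lemma kdiff_eq: "kdiff (length xs) (xpow xs n) = d n"
  by (auto simp: fun_eq_iff kdiff_def d_def D_def xpow_def)

lemma ktrans_eq: "ktrans xs n N = tr n N"
  by (auto simp: fun_eq_iff ktrans_def tr_def \<Phi>_def)

lemma qp_zero: "0 \<in> qp q e"
  by (rule is_ideal_zero[OF stable_ideal[OF stable_qp]])

text \<open>The twist equals i * n only on sets of size i; on all other sets the cochain is zero,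
  and zero lies in every power.\<close>

lemma CC_iff: "c \<in> CC n e (int i) \<longleftrightarrow> c \<in> cochains (length xs) i \<and> (\<forall>T. c T \<in> qp q (e + int i * int n))"
proof -
  have *: "c T \<in> qp q (e + int (sum (\<lambda>_. n) T)) \<longleftrightarrow> c T \<in> qp q (e + int i * int n)"
    if "c \<in> cochains (length xs) i" for T
    using that qp_zero by (cases "c T = 0") (auto simp: cochains_def)
  have "c \<in> CC n e (int i) \<longleftrightarrow>
      c \<in> cochains (length xs) i \<and> (\<forall>T. c T \<in> qp q (e + int (sum (\<lambda>_. n) T)))"
    unfolding CC_def Coch_def cochains_def mem_Collect_eq of_nat_eq_iff by blast
  then show ?thesis using * by blast
qed

lemma Gcochains_eq: "Gcochains q (length xs) n e i = CC n e (int i)"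
  by (auto simp: CC_iff Gcochains_def)

lemma CC_neg: "p < 0 \<Longrightarrow> CC n e p = {0}"
  unfolding CC_def Coch_def using qp_zero by (auto simp: fun_eq_iff)

lemma d_hom:
  assumes "c \<in> CC n e (int i)" "j = i + 1"
  shows "d n c \<in> CC n e' (int j) \<longleftrightarrow> (\<forall>T. d n c T \<in> qp q (e' + int j * int n))"
proof -
  have "d n c \<in> CC n e (int j)" using d_CC[of c n e "int j"] assms by simp
  then show ?thesis unfolding CC_iff by blast
qed

lemma Gcocycle_iff: "Gcocycle q xs n e i z \<longleftrightarrow> z \<in> CC n e (int i) \<and> d n z \<in> CC n (e + 1) (int i + 1)"
  using d_hom[of z n e i "i + 1" "e + 1"] by (auto simp: Gcocycle_def Gcochains_eq kdiff_eq algebra_simps)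

text \<open>The case distinction for degree 0 is absorbed by integer cohomological degrees: in
  degree -1 the only cochain is 0.\<close>

lemma Gcobdry_iff:
  assumes z: "z \<in> CC n e (int i)"
  shows "Gcobdry q xs n e i z \<longleftrightarrow> (\<exists>b\<in>CC n e (int i - 1). z - d n b \<in> CC n (e + 1) (int i))"
proof (cases i)
  case 0
  then show ?thesis
    using z by (simp add: Gcobdry_def CC_neg d_linear CC_iff[of _ _ _ 0, simplified])
next
  case (Suc j)
  have "z - d n b \<in> CC n (e + 1) (int i) \<longleftrightarrow> (\<forall>T. z T - d n b T \<in> qp q (e + int i * int n + 1))"
    if "b \<in> CC n e (int j)" for b
  proof -
    have "z - d n b \<in> CC n e (int i)"
      using CC_linear(3)[OF z d_CC] that Suc by simp
    then show ?thesis by (auto simp: CC_iff algebra_simps)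
  qed
  then show ?thesis
    using Suc by (simp add: Gcobdry_def kdiff_eq Gcochains_eq)
qed

lemma LCG_zero_iff: "LCG_zero q xs i e \<longleftrightarrow> G.vanish 0 (int i) e"
  unfolding LCG_zero_def G_vanish Gcocycle_iff ktrans_eq
  using Gcobdry_iff tr_CC by meson

lemma fun_diff: "(\<lambda>T. f T - g T) = (f - g :: nat set \<Rightarrow> 'a)"
  by (simp add: fun_eq_iff)

lemma fG_surj_iff: "fG_surj q xs i \<longleftrightarrow> surj_G (int i)"
proof -
  have "Gcobdry q xs N e i (tr 1 N w - tr n N z) \<longleftrightarrow>
      (\<exists>b\<in>CC N e (int i - 1). tr 1 N w - tr n N z - d N b \<in> CC N (e + 1) (int i))"
    if "w \<in> CC 1 e (int i)" "z \<in> CC n e (int i)" "n \<ge> 1" "N \<ge> n" for N w n z e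
    by (rule Gcobdry_iff[OF CC_linear(3)]) (use that in \<open>auto intro: tr_CC\<close>)
  then show ?thesis
    unfolding fG_surj_def surj_G_def Gcocycle_iff ktrans_eq fun_diff by blast
qed

lemma cochains_CC: "c \<in> cochains (length xs) i \<Longrightarrow> e + int i * int n \<le> 0 \<Longrightarrow> c \<in> CC n e (int i)"
  by (simp add: CC_iff qp_def)

text \<open>At the level -i * n the filtration condition reads q^0 and is void.\<close>

lemma cochains_iff: "c \<in> cochains (length xs) i \<longleftrightarrow> (\<exists>e. c \<in> CC n e (int i))"
proof
  assume "c \<in> cochains (length xs) i"
  then have "c \<in> CC n (- (int i * int n)) (int i)" by (rule cochains_CC) simp
  then show "\<exists>e. c \<in> CC n e (int i)" ..
qed (auto simp: CC_iff)

lemma cocyclesA_iff: "z \<in> cocyclesA (length xs) (xpow xs n) i \<longleftrightarrow> (\<exists>e. z \<in> CC n e (int i)) \<and> d n z = 0"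
  unfolding cocyclesA_def kdiff_eq zero_fun_def[symmetric] mem_Collect_eq
  using cochains_iff by blast

lemma coboundariesA_iff:
  "z \<in> coboundariesA (length xs) (xpow xs n) i \<longleftrightarrow> (\<exists>e. \<exists>b\<in>CC n e (int i - 1). z = d n b)"
proof (cases i)
  case 0
  then show ?thesis
    using CC_neg[of "-1"] d_linear(4) by (simp add: coboundariesA_def flip: zero_fun_def)
next
  case (Suc j)
  then have "z \<in> coboundariesA (length xs) (xpow xs n) i \<longleftrightarrow> (\<exists>b\<in>cochains (length xs) j. z = d n b)"
    by (auto simp: coboundariesA_def kdiff_eq)
  also have "\<dots> \<longleftrightarrow> (\<exists>e. \<exists>b\<in>CC n e (int j). z = d n b)"
    using cochains_iff[of _ j n] by blast
  finally show ?thesis using Suc by simp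
qed

lemma fA_surj_iff: "fA_surj xs i \<longleftrightarrow> surj_A (int i)"
proof -
  define P where "P n z \<longleftrightarrow> (\<exists>f. \<exists>w\<in>CC 1 f (int i). d 1 w = 0 \<and>
    (\<exists>N\<ge>n. \<exists>b\<in>CC N f (int i - 1). tr 1 N w - tr n N z = d N b))" for n z
  have P: "(\<exists>w\<in>cocyclesA (length xs) (xpow xs 1) i. \<exists>N\<ge>n.
      tr 1 N w - tr n N z \<in> coboundariesA (length xs) (xpow xs N) i) \<longleftrightarrow> P n z" for n z
  proof
    assume "\<exists>w\<in>cocyclesA (length xs) (xpow xs 1) i. \<exists>N\<ge>n.
      tr 1 N w - tr n N z \<in> coboundariesA (length xs) (xpow xs N) i"
    then obtain w N where w: "w \<in> cocyclesA (length xs) (xpow xs 1) i" "n \<le> N"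
      "tr 1 N w - tr n N z \<in> coboundariesA (length xs) (xpow xs N) i" by blast
    then obtain e f b where *: "w \<in> CC 1 e (int i)" "d 1 w = 0" "n \<le> N"
      "b \<in> CC N f (int i - 1)" "tr 1 N w - tr n N z = d N b"
      unfolding cocyclesA_iff coboundariesA_iff by blast
    \<comment> \<open>Cocycle and coboundary arrive with independent levels; the smaller one
      accommodates both.\<close>
    then have "w \<in> CC 1 (min e f) (int i)" "b \<in> CC N (min e f) (int i - 1)"
      using CC_mono[OF min.cobounded1] CC_mono[OF min.cobounded2] by blast+
    then show "P n z" unfolding P_def using *(2,3,5) by blast
  next
    assume "P n z"
    then obtain f w N b where "w \<in> CC 1 f (int i)" "d 1 w = 0" "n \<le> N"
      "b \<in> CC N f (int i - 1)" "tr 1 N w - tr n N z = d N b"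
      unfolding P_def by blast
    then show "\<exists>w\<in>cocyclesA (length xs) (xpow xs 1) i. \<exists>N\<ge>n.
      tr 1 N w - tr n N z \<in> coboundariesA (length xs) (xpow xs N) i"
      using cocyclesA_iff coboundariesA_iff by blast
  qed
  have "fA_surj xs i \<longleftrightarrow> (\<forall>n\<ge>1. \<forall>z\<in>cocyclesA (length xs) (xpow xs n) i. P n z)"
    unfolding fA_surj_def ktrans_eq fun_diff P ..
  also have "\<dots> \<longleftrightarrow> surj_A (int i)"
    unfolding surj_A_def P_def[symmetric] using cocyclesA_iff by blast
  finally show ?thesis .
qed

end

theorem theorem1p2:
  fixes q :: "'a::comm_ring_1 set" and xs :: "'a list" and k t :: int
  assumes "noetherian_ring TYPE('a)"
    and "is_ideal q"
    and "ideal_gen (set xs) = q"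
    and "\<forall>i::nat. int i < t \<longrightarrow> (\<forall>n::int. n \<noteq> k - 1 \<and> n \<noteq> k \<longrightarrow> LCG_zero q xs i (n - int i))"
    and "0 \<le> t \<longrightarrow> (\<forall>n::int. n > k \<longrightarrow> LCG_zero q xs (nat t) (n - t))"
  shows "(\<forall>i::nat. int i < t \<longrightarrow> fA_surj xs i) \<longleftrightarrow> (\<forall>i::nat. int i < t \<longrightarrow> fG_surj q xs i)"
proof -
  interpret ideal_generators xs q
    using assms(1,3) by unfold_locales
  have below: "G.vanish 0 i e" if "0 \<le> i" "i < t" "e + i \<noteq> k - 1" "e + i \<noteq> k" for i e
    using assms(4)[rule_format, of "nat i" "e + i"] that by (simp add: LCG_zero_iff)
  have top: "G.vanish 0 t e" if "0 \<le> t" "e + t > k" for e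
    using assms(5)[rule_format, of "e + t"] that by (simp add: LCG_zero_iff)
  show ?thesis
    unfolding fA_surj_iff fG_surj_iff
    using surj_A_if_surj_G[OF below top] surj_G_if_surj_A[OF below top] by blast
qed

end
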